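(* Let $X\subseteq\mathbb C$ be compact and $H$ a hole of $X$. Suppose that $f\in P(X)$ is injective, and let $f^*$ be the Gelfand transform of $f$ on $\widehat X$. Under each of the following conditions $f^*$ is injective on $\overline H$: (1) $f$ maps the outer boundary of the compact set $\partial\overline H$ onto the outer boundary of $f(\partial\overline H)$; (2) $H$ is contained in a hole $G$ of the outer boundary of $X$ which has the property that $G$ is the only hole of $\partial G$; (3) $H$ is a regular hole of $X$.
   Context: For compact $X\subseteq\mathbb C$, $P(X)$ is the uniform closure in $C(X)$ (complex-valued continuous functions on $X$) of the restrictions to $X$ of polynomials in $z$. A hole of a compact set $E\subseteq\mathbb C$ is a bounded connected component of $\mathbb C\setminus E$. The polynomial convex hull $\widehat E$ of $E$ is the union of $E$ with all its holes. The outer boundary of $E$ is $\partial\widehat E$. For $f\in P(X)$, the Gelfand transform $f^*$ of $f$ is the unique continuous extension of $f$ to $\widehat X$ which is holomorphic in the interior of $\widehat X$ (equivalently: if polynomials $p_n\to f$ uniformly on $X$, then $f^*$ is the uniform limit of $(p_n)$ on $\widehat X$). A hole $H$ of $X$ is called regular if $H$ is the only hole of its boundary $\partial H$, that is, if $\widehat{\partial H}=H\cup\partial H=\overline H$. *)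

theory Defs
  imports "HOL-Complex_Analysis.Complex_Analysis"
    "HOL-Computational_Algebra.Polynomial"
begin

definition holes :: "complex set \<Rightarrow> complex set set" where
  "holes E = {H \<in> components (- E). bounded H}"

definition poly_hull :: "complex set \<Rightarrow> complex set" where
  "poly_hull E = E \<union> \<Union> (holes E)"

definition outer_boundary :: "complex set \<Rightarrow> complex set" where
  "outer_boundary E = frontier (poly_hull E)"

text \<open>
  Elements of \<open>C(X)\<close> are represented by total functions; only their values on \<open>X\<close> matter.
\<close>

definition P_alg :: "complex set \<Rightarrow> (complex \<Rightarrow> complex) set" where
  "P_alg X = {f. continuous_on X f \<and>
     (\<forall>e>0. \<exists>p :: complex poly. \<forall>z\<in>X. cmod (f z - poly p z) < e)}"

text \<open>
  The value \<open>0\<close> off the hull is a dummy that makes the extension unique as a total function;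
  existence and uniqueness are proved in \<open>gelfand_ex1\<close>.
\<close>

definition gelfand :: "complex set \<Rightarrow> (complex \<Rightarrow> complex) \<Rightarrow> complex \<Rightarrow> complex" where
  "gelfand X f = (THE g. continuous_on (poly_hull X) g \<and>
     g holomorphic_on interior (poly_hull X) \<and> (\<forall>z\<in>X. g z = f z) \<and>
     (\<forall>z. z \<notin> poly_hull X \<longrightarrow> g z = 0))"

definition regular_hole :: "complex set \<Rightarrow> complex set \<Rightarrow> bool" where
  "regular_hole X H \<longleftrightarrow> H \<in> holes X \<and> holes (frontier H) = {H}"

lemma poly_hull_eq_inside: "poly_hull E = E \<union> inside E"
proof -
  have "\<Union> (holes E) = inside E"
  proof (intro set_eqI iffI)
    fix x assume "x \<in> \<Union> (holes E)"
    then obtain y where "x \<in> connected_component_set (- E) y"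
        "bounded (connected_component_set (- E) y)"
      by (auto simp: holes_def components_iff)
    then show "x \<in> inside E"
      unfolding inside_def using connected_component_eq connected_component_in
      by (metis (mono_tags, lifting) Compl_iff mem_Collect_eq)
  next
    fix x assume "x \<in> inside E"
    then have "x \<in> - E" "bounded (connected_component_set (- E) x)"
      by (auto simp: inside_def)
    then show "x \<in> \<Union> (holes E)"
      by (intro UnionI[of "connected_component_set (- E) x"])
        (auto simp: holes_def components_iff)
  qed
  then show ?thesis by (simp add: poly_hull_def)
qed

lemma compact_poly_hull:
  assumes "compact X" shows "compact (poly_hull X)"
proof -
  have "closed (poly_hull X)"
    unfolding poly_hull_eq_inside union_with_inside
    by (simp add: closed_Compl open_outside[OF compact_imp_closed[OF assms]])
  moreover have "bounded (poly_hull X)"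
    unfolding poly_hull_eq_inside using assms
    by (simp add: bounded_inside compact_imp_bounded)
  ultimately show ?thesis by (simp add: compact_eq_bounded_closed)
qed

lemma outer_boundary_subset:
  assumes "compact X" shows "outer_boundary X \<subseteq> X"
proof -
  have "inside X \<subseteq> interior (poly_hull X)"
    unfolding poly_hull_eq_inside using assms
    by (intro interior_maximal) (auto simp: compact_imp_closed open_inside)
  moreover have "closure (poly_hull X) = poly_hull X"
    using compact_poly_hull[OF assms] by (simp add: compact_imp_closed)
  ultimately show ?thesis
    by (auto simp: outer_boundary_def frontier_def poly_hull_eq_inside)
qed

lemma max_modulus_poly_hull:
  assumes "compact X" "continuous_on (poly_hull X) g" "g holomorphic_on interior (poly_hull X)"
    and "\<And>z. z \<in> X \<Longrightarrow> cmod (g z) \<le> B" and "z \<in> poly_hull X"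
  shows "cmod (g z) \<le> B"
proof (rule maximum_modulus_frontier[of g "poly_hull X"])
  have c: "compact (poly_hull X)" by (rule compact_poly_hull[OF assms(1)])
  then show "continuous_on (closure (poly_hull X)) g"
    using assms(2) by (simp add: compact_imp_closed)
  show "bounded (poly_hull X)" using c by (rule compact_imp_bounded)
  show "cmod (g w) \<le> B" if "w \<in> frontier (poly_hull X)" for w
    using that outer_boundary_subset[OF assms(1)] assms(4) by (auto simp: outer_boundary_def)
qed (use assms in auto)

lemma gelfand_ex1:
  assumes X: "compact X" and f: "f \<in> P_alg X"
  shows "\<exists>!g. continuous_on (poly_hull X) g \<and>
     g holomorphic_on interior (poly_hull X) \<and> (\<forall>z\<in>X. g z = f z) \<and>
     (\<forall>z. z \<notin> poly_hull X \<longrightarrow> g z = 0)"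
proof (rule ex_ex1I)
  let ?K = "poly_hull X"
  have "\<forall>n. \<exists>p :: complex poly. \<forall>z\<in>X. cmod (f z - poly p z) < 1 / Suc n"
    using f by (auto simp: P_alg_def)
  then obtain p :: "nat \<Rightarrow> complex poly"
    where p: "\<And>n z. z \<in> X \<Longrightarrow> cmod (f z - poly (p n) z) < 1 / Suc n"
    by metis
  have ul: "uniform_limit X (\<lambda>n. poly (p n)) f sequentially"
    unfolding uniform_limit_sequentially_iff
  proof (intro allI impI)
    fix e :: real assume "e > 0"
    then obtain N where N: "inverse (real (Suc N)) < e" using reals_Archimedean by blast
    have "dist (poly (p n) z) (f z) < e" if "n \<ge> N" "z \<in> X" for n z
    proof -
      have "1 / real (Suc n) \<le> inverse (real (Suc N))"
        using that by (simp add: field_simps)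
      then show ?thesis using p[OF that(2), of n] N by (simp add: dist_norm norm_minus_commute)
    qed
    then show "\<exists>N. \<forall>n\<ge>N. \<forall>x\<in>X. dist (poly (p n) x) (f x) < e" by blast
  qed
  then have uc: "uniformly_Cauchy_on X (\<lambda>n. poly (p n))"
    using uniformly_convergentI uniformly_convergent_Cauchy by blast
  have hol: "poly q holomorphic_on S" for q :: "complex poly" and S
    by (intro holomorphic_intros)
  have "uniformly_Cauchy_on ?K (\<lambda>n. poly (p n))"
  proof (rule uniformly_Cauchy_onI)
    fix e :: real assume "e > 0"
    then have "e / 2 > 0" by simp
    then obtain M where M: "\<And>x m n. x \<in> X \<Longrightarrow> m \<ge> M \<Longrightarrow> n \<ge> M \<Longrightarrow>
        dist (poly (p m) x) (poly (p n) x) < e / 2"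
      using uc unfolding uniformly_Cauchy_on_def by meson
    have "dist (poly (p m) z) (poly (p n) z) < e" if "z \<in> ?K" "m \<ge> M" "n \<ge> M" for m n z
    proof -
      have "cmod (poly (p m - p n) z) \<le> e / 2"
      proof (rule max_modulus_poly_hull[OF X _ _ _ that(1)])
        show "continuous_on ?K (poly (p m - p n))" by (intro continuous_intros)
        show "poly (p m - p n) holomorphic_on interior ?K" by (rule hol)
        show "cmod (poly (p m - p n) w) \<le> e / 2" if "w \<in> X" for w
          using M[OF that \<open>m \<ge> M\<close> \<open>n \<ge> M\<close>] by (simp add: dist_norm)
      qed
      then show ?thesis using \<open>e > 0\<close> by (simp add: dist_norm)
    qed
    then show "\<exists>M. \<forall>x\<in>?K. \<forall>m\<ge>M. \<forall>n\<ge>M. dist (poly (p m) x) (poly (p n) x) < e" by blast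
  qed
  then obtain g where g: "uniform_limit ?K (\<lambda>n. poly (p n)) g sequentially"
    using Cauchy_uniformly_convergent uniformly_convergent_on_def by blast
  define h where "h = (\<lambda>z. if z \<in> ?K then g z else 0)"
  have h: "uniform_limit ?K (\<lambda>n. poly (p n)) h sequentially"
    using g by (rule uniform_limit_cong[THEN iffD1, rotated -1]) (auto simp: h_def)
  have "continuous_on ?K h"
    by (rule uniform_limit_theorem[OF _ h]) (auto intro!: always_eventually continuous_intros)
  moreover have "h holomorphic_on interior ?K"
  proof (rule holomorphic_uniform_sequence)
    fix x assume "x \<in> interior ?K"
    then obtain d where "d > 0" "cball x d \<subseteq> interior ?K"
      using open_contains_cball open_interior by blast
    moreover from this have "cball x d \<subseteq> ?K" using interior_subset by blast
    ultimately show "\<exists>d>0. cball x d \<subseteq> interior ?K \<and>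
        uniform_limit (cball x d) (\<lambda>n. poly (p n)) h sequentially"
      using uniform_limit_on_subset[OF h] by blast
  qed (auto intro: hol)
  moreover have "h z = f z" if "z \<in> X" for z
  proof -
    have "z \<in> ?K" using that by (simp add: poly_hull_def)
    then show ?thesis
      using tendsto_uniform_limitI[OF h] tendsto_uniform_limitI[OF ul that] LIMSEQ_unique by blast
  qed
  ultimately show "\<exists>g. continuous_on ?K g \<and> g holomorphic_on interior ?K \<and>
      (\<forall>z\<in>X. g z = f z) \<and> (\<forall>z. z \<notin> ?K \<longrightarrow> g z = 0)"
    by (intro exI[of _ h]) (auto simp: h_def)
next
  let ?K = "poly_hull X"
  fix g h
  assume g: "continuous_on ?K g \<and> g holomorphic_on interior ?K \<and>
      (\<forall>z\<in>X. g z = f z) \<and> (\<forall>z. z \<notin> ?K \<longrightarrow> g z = 0)"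
    and h: "continuous_on ?K h \<and> h holomorphic_on interior ?K \<and>
      (\<forall>z\<in>X. h z = f z) \<and> (\<forall>z. z \<notin> ?K \<longrightarrow> h z = 0)"
  have "cmod (g z - h z) \<le> 0" if "z \<in> ?K" for z
    by (rule max_modulus_poly_hull[OF X _ _ _ that, of "\<lambda>z. g z - h z"])
      (use g h in \<open>auto intro!: continuous_intros holomorphic_intros\<close>)
  then have "g z = h z" for z
    using g h by (cases "z \<in> ?K") auto
  then show "g = h" by blast
qed

end

theory Submission
  imports Defs "HOL-Computational_Algebra.Fundamental_Theorem_Algebra"
begin

text \<open>
  Let \<open>V\<close> be a bounded domain with \<open>frontier V \<subseteq> X\<close>, \<open>g\<close> the Gelfand transform and \<open>L = g ` frontier V\<close>.
  A zero-free function on \<open>frontier V\<close> has at most one index \<open>d\<close>: it is \<open>(z - b) powi d\<close> times a function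
  that extends without zeros to \<open>closure V\<close>. Polynomial approximation shows that \<open>g - w\<close> has an
  index, at least its number of zeros in \<open>V\<close>. By Eilenberg's factorization of zero-free functions on
  the compact set \<open>L\<close>, the inverse \<open>\<psi>\<close> of \<open>g\<close> satisfies \<open>\<psi> u - a = exp (h u) * (\<Prod>k. (u - k) powi r k)\<close>. Comparing
  indices after the substitution \<open>u = g z\<close> gives \<open>1 = (\<Sum>k. r k * index (g - k))\<close>. If \<open>g ` V\<close> meets only one
  component of \<open>- L\<close>, all the nonzero indices agree, hence equal \<open>1\<close>, and \<open>g\<close> takes no value off
  \<open>L\<close> twice on \<open>V\<close>; the open mapping theorem and invariance of domain then give injectivity on \<open>closure V\<close>.

  For (2) and (3) take \<open>V = G\<close> and \<open>V = H\<close>. For (1) take the component of the interior of the hull of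
  \<open>frontier (closure H)\<close> that contains \<open>H\<close>: its frontier is the whole outer boundary.
\<close>

section \<open>Continuous logarithms in the plane\<close>

lemma exp_eq_one_const:
  assumes "connected S" "continuous_on S k" "\<And>t. t \<in> S \<Longrightarrow> exp (k t) = 1"
  shows "\<exists>n::int. \<forall>t\<in>S. k t = 2 * pi * n * \<i>"
proof -
  have val: "\<exists>n::int. k t = 2 * pi * n * \<i>" if t: "t \<in> S" for t
  proof -
    obtain n::int where "Re (k t) = 0" "Im (k t) = of_int (2 * n) * pi"
      using assms(3)[OF t] unfolding exp_eq_1 by blast
    then show ?thesis by (intro exI[of _ n]) (simp add: complex_eq_iff)
  qed
  have "k constant_on S"
  proof (rule continuous_discrete_range_constant[OF assms(1,2)])
    fix x assume x: "x \<in> S"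
    have "2 * pi \<le> norm (k y - k x)" if y: "y \<in> S" "k y \<noteq> k x" for y
    proof -
      obtain m n :: int where mn: "k x = 2 * pi * m * \<i>" "k y = 2 * pi * n * \<i>"
        using val x y by meson
      then have "1 \<le> \<bar>real_of_int (n - m)\<bar>" using y by auto
      moreover have "k y - k x = of_real (2 * pi * (n - m)) * \<i>"
        using mn by (simp add: algebra_simps)
      then have "norm (k y - k x) = 2 * pi * \<bar>real_of_int (n - m)\<bar>"
        by (simp only: norm_mult norm_of_real norm_ii abs_mult) simp
      ultimately show ?thesis by simp
    qed
    then show "\<exists>e>0. \<forall>y. y \<in> S \<and> k y \<noteq> k x \<longrightarrow> e \<le> norm (k y - k x)"
      by (intro exI[of _ "2 * pi"]) auto
  qed
  then show ?thesis using val unfolding constant_on_def by metis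
qed

text \<open>Along the circle, \<open>h\<close> and \<open>m * (ln R + \<i> * t)\<close> are
  logarithms of the same function and differ by a constant; the first returns to its initial value
  after one turn, the second grows by \<open>2 * pi * m * \<i>\<close>.\<close>

lemma power_int_log_on_circle:
  fixes m :: int and b :: complex
  assumes "R > 0" "continuous_on (sphere b R) h"
    and "\<And>z. z \<in> sphere b R \<Longrightarrow> (z - b) powi m = exp (h z)"
  shows "m = 0"
proof -
  define k where "k = (\<lambda>t. h (b + of_real R * exp (\<i> * of_real t)) - of_int m * (of_real (ln R) + \<i> * of_real t))"
  have *: "b + of_real R * exp (\<i> * of_real t) \<in> sphere b R" for t
    using assms(1) by (simp add: dist_norm norm_mult)
  have "continuous_on {0..2*pi} k"
    unfolding k_def
    by (intro continuous_intros continuous_on_compose2[OF assms(2)]) (use * in auto)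
  moreover have "exp (k t) = 1" for t
  proof -
    have "exp (of_int m * (of_real (ln R) + \<i> * of_real t)) = (exp (of_real (ln R) + \<i> * of_real t) :: complex) powi m"
      by (simp add: exp_power_int)
    also have "exp (of_real (ln R) + \<i> * of_real t) = of_real R * exp (\<i> * of_real t)"
      using assms(1) by (simp add: exp_add exp_of_real)
    also have "\<dots> powi m = exp (h (b + of_real R * exp (\<i> * of_real t)))"
      using assms(3)[OF *, of t] by simp
    finally show ?thesis by (simp add: k_def exp_diff)
  qed
  ultimately obtain n::int where n: "\<And>t. t \<in> {0..2*pi} \<Longrightarrow> k t = 2 * pi * n * \<i>"
    using exp_eq_one_const[of "{0..2*pi}" k] by auto
  have "k 0 = k (2*pi)" using n[of 0] n[of "2*pi"] by simp
  moreover have "exp (\<i> * (2 * complex_of_real pi)) = 1"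
    by (metis exp_two_pi_i mult.assoc mult.commute)
  ultimately show ?thesis by (simp add: k_def algebra_simps)
qed

text \<open>The relation between \<open>a\<close> and \<open>b\<close> is an equivalence that holds
  for nearby points off \<open>S\<close>; connectedness of the component spreads it.\<close>

lemma log_ratio:
  fixes S :: "complex set"
  assumes "closed S" "connected_component (-S) a b"
  shows "\<exists>h. continuous_on S h \<and> (\<forall>z\<in>S. z - a = (z - b) * exp (h z))"
proof -
  define C where "C = connected_component_set (-S) a"
  have C: "connected C" "C \<subseteq> -S" "a \<in> C" "b \<in> C" "open C"
    using assms connected_component_subset[of "-S" a] connected_component_in[OF assms(2)]
    by (auto simp: C_def closed_def intro!: open_connected_component)
  define R where "R = (\<lambda>a b. \<exists>h. continuous_on S h \<and> (\<forall>z\<in>S. z - a = (z - b) * exp (h z)))"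
  have "R a b"
  proof (rule connected_equivalence_relation[OF C(1,3,4)])
    fix x y assume "R x y"
    then obtain h where "continuous_on S h" "\<forall>z\<in>S. z - x = (z - y) * exp (h z)"
      by (auto simp: R_def)
    then show "R y x"
      unfolding R_def
      by (intro exI[of _ "\<lambda>z. - h z"]) (auto intro!: continuous_intros simp: exp_minus)
  next
    fix x y z assume "R x y" "R y z"
    then obtain h k where "continuous_on S h" "\<forall>u\<in>S. u - x = (u - y) * exp (h u)"
      "continuous_on S k" "\<forall>u\<in>S. u - y = (u - z) * exp (k u)"
      unfolding R_def by blast
    then show "R x z"
      unfolding R_def
      by (intro exI[of _ "\<lambda>u. h u + k u"]) (auto intro!: continuous_intros simp: exp_add)
  next
    fix x assume x: "x \<in> C"
    then obtain e where e: "e > 0" "ball x e \<subseteq> C" using C openE by blast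
    have "R x y" if y: "y \<in> ball x e" for y
    proof -
      have ne: "z \<noteq> x" "z \<noteq> y" "norm (x - y) < norm (z - x)" if z: "z \<in> S" for z
      proof -
        have "z \<notin> ball x e" using e C z by auto
        then show "norm (x - y) < norm (z - x)" "z \<noteq> x" "z \<noteq> y"
          using y e by (auto simp: dist_norm norm_minus_commute)
      qed
      \<comment> \<open>This number is \<open>(z - y) / (z - x)\<close>; \<open>Ln\<close> is
        continuous on the right half plane.\<close>
      have re: "Re (1 + (x - y) / (z - x)) > 0" if z: "z \<in> S" for z
      proof -
        have "norm ((x - y) / (z - x)) < 1" using ne[OF z] by (simp add: norm_divide)
        then have "\<bar>Re ((x - y) / (z - x))\<bar> < 1" using abs_Re_le_cmod le_less_trans by blast
        then show ?thesis by simp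
      qed
      define h where "h = (\<lambda>z. - Ln (1 + (x - y) / (z - x)))"
      have "continuous_on S h" unfolding h_def
        by (intro continuous_intros) (use re ne in \<open>auto simp: complex_nonpos_Reals_iff\<close>, use re in force)
      moreover have "z - x = (z - y) * exp (h z)" if z: "z \<in> S" for z
      proof -
        have "1 + (x - y) / (z - x) \<noteq> 0" using re[OF z] by force
        then have "exp (h z) = inverse (1 + (x - y) / (z - x))" by (simp add: h_def exp_minus)
        also have "1 + (x - y) / (z - x) = (z - y) / (z - x)" using ne[OF z] by (simp add: field_simps)
        finally show ?thesis using ne[OF z] by simp
      qed
      ultimately show ?thesis unfolding R_def by blast
    qed
    then show "\<exists>T. openin (top_of_set C) T \<and> x \<in> T \<and> (\<forall>y\<in>T. R x y)"
      using e C by (intro exI[of _ "ball x e"]) (auto simp: openin_open_eq)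
  qed
  then show ?thesis by (simp add: R_def)
qed

text \<open>Within its unbounded component, \<open>a\<close> can be moved to a \<open>b\<close> of
  larger norm than all points of \<open>S\<close>. There \<open>z - b = (1 - z / b) * (- b)\<close>,
  with the first factor in the right half plane.\<close>

lemma log_outside:
  fixes S :: "complex set"
  assumes "compact S" "a \<in> outside S"
  shows "\<exists>h. continuous_on S h \<and> (\<forall>z\<in>S. z - a = exp (h z))"
proof -
  obtain B where B: "B > 0" "\<And>z. z \<in> S \<Longrightarrow> norm z \<le> B"
    using assms(1) compact_imp_bounded bounded_pos by metis
  have "\<not> bounded (connected_component_set (-S) a)"
    using assms(2) by (auto simp: outside_def)
  then obtain b where b: "connected_component (-S) a b" "norm b > B"
    by (auto simp: bounded_iff not_le)
  obtain k where k: "continuous_on S k" "\<And>z. z \<in> S \<Longrightarrow> z - a = (z - b) * exp (k z)"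
    using log_ratio[OF compact_imp_closed[OF assms(1)] b(1)] by blast
  have re: "Re (1 - z / b) > 0" if "z \<in> S" for z
  proof -
    have "norm (z / b) < 1" using B(1) B(2)[OF that] b(2) by (simp add: norm_divide divide_less_eq)
    then have "\<bar>Re (z / b)\<bar> < 1" using abs_Re_le_cmod le_less_trans by blast
    then show ?thesis by simp
  qed
  have "b \<noteq> 0" using b B by auto
  define h where "h = (\<lambda>z. k z + Ln (1 - z / b) + Ln (- b))"
  have "continuous_on S h" unfolding h_def
    by (intro continuous_intros k) (use re \<open>b \<noteq> 0\<close> in \<open>auto simp: complex_nonpos_Reals_iff\<close>, use re in force)
  moreover have "z - a = exp (h z)" if z: "z \<in> S" for z
  proof -
    have "1 - z / b \<noteq> 0" using re[OF z] by force
    then have "exp (h z) = exp (k z) * ((1 - z / b) * (- b))"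
      using \<open>b \<noteq> 0\<close> by (simp add: h_def exp_add)
    also have "(1 - z / b) * (- b) = z - b" using \<open>b \<noteq> 0\<close> by (simp add: field_simps)
    finally show ?thesis using k(2)[OF z] by simp
  qed
  ultimately show ?thesis by blast
qed

section \<open>The index of a function on the frontier of a bounded open set\<close>

text \<open>The exponent \<open>d\<close> is unique when \<open>V\<close> is bounded and open with \<open>b \<in> V\<close>, see \<open>winds_unique\<close>; for a Jordan
  domain it is the winding number of \<open>\<phi>\<close> around \<open>0\<close> along the boundary.\<close>
definition winds :: "complex set \<Rightarrow> complex \<Rightarrow> (complex \<Rightarrow> complex) \<Rightarrow> int \<Rightarrow> bool" where
  "winds V b \<phi> d \<longleftrightarrow> (\<exists>E. continuous_on (closure V) E \<and> (\<forall>z\<in>closure V. E z \<noteq> 0) \<and>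
     (\<forall>z\<in>frontier V. \<phi> z = (z - b) powi d * E z))"

lemma windsE:
  assumes "winds V b \<phi> d"
  obtains E where "continuous_on (closure V) E" "\<And>z. z \<in> closure V \<Longrightarrow> E z \<noteq> 0"
    "\<And>z. z \<in> frontier V \<Longrightarrow> \<phi> z = (z - b) powi d * E z"
  using assms unfolding winds_def by blast

lemma winds_cong:
  assumes "winds V b \<phi> d" "\<And>z. z \<in> frontier V \<Longrightarrow> \<psi> z = \<phi> z"
  shows "winds V b \<psi> d"
  using assms unfolding winds_def by auto

lemma winds_nonvanishing:
  assumes "continuous_on (closure V) E" "\<And>z. z \<in> closure V \<Longrightarrow> E z \<noteq> 0"
  shows "winds V b E 0"
  using assms unfolding winds_def by auto

text \<open>Tietze extends the exponent, and an exponential never vanishes.\<close>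

lemma winds_exp:
  assumes "continuous_on (frontier V) h"
  shows "winds V b (\<lambda>z. exp (h z)) 0"
proof -
  obtain k where "continuous_on (closure V) k" "\<And>z. z \<in> frontier V \<Longrightarrow> k z = h z"
    using Tietze_unbounded[OF assms, of "closure V"]
    by (metis closed_subset frontier_closed frontier_def Diff_subset)
  moreover have "winds V b (\<lambda>z. exp (k z)) 0"
    by (rule winds_nonvanishing) (auto intro!: continuous_intros calculation)
  ultimately show ?thesis by (auto elim!: winds_cong)
qed

lemma winds_mult:
  assumes "open V" "b \<in> V" "winds V b \<phi> d" "winds V b \<psi> e"
  shows "winds V b (\<lambda>z. \<phi> z * \<psi> z) (d + e)"
proof -
  obtain E F where "continuous_on (closure V) E" "\<forall>z\<in>closure V. E z \<noteq> 0"
      "\<forall>z\<in>frontier V. \<phi> z = (z - b) powi d * E z"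
      "continuous_on (closure V) F" "\<forall>z\<in>closure V. F z \<noteq> 0"
      "\<forall>z\<in>frontier V. \<psi> z = (z - b) powi e * F z"
    using assms(3,4) unfolding winds_def by auto
  moreover have "z \<noteq> b" if "z \<in> frontier V" for z
    using that assms(1,2) by (auto simp: frontier_def interior_open)
  ultimately show ?thesis
    unfolding winds_def
    by (intro exI[of _ "\<lambda>z. E z * F z"]) (auto intro!: continuous_intros simp: power_int_add)
qed

lemma winds_power_int:
  assumes "winds V b \<phi> d"
  shows "winds V b (\<lambda>z. \<phi> z powi m) (d * m)"
proof -
  obtain E where "continuous_on (closure V) E" "\<forall>z\<in>closure V. E z \<noteq> 0"
      "\<forall>z\<in>frontier V. \<phi> z = (z - b) powi d * E z"
    using assms unfolding winds_def by auto
  then show ?thesis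
    unfolding winds_def
    by (intro exI[of _ "\<lambda>z. E z powi m"])
      (auto intro!: continuous_intros simp: power_int_mult power_int_mult_distrib)
qed

lemma winds_prod:
  assumes "open V" "b \<in> V" "finite K" "\<And>k. k \<in> K \<Longrightarrow> winds V b (\<phi> k) (d k)"
  shows "winds V b (\<lambda>z. \<Prod>k\<in>K. \<phi> k z) (\<Sum>k\<in>K. d k)"
  using assms(3,4)
proof (induction K rule: finite_induct)
  case empty
  show ?case by (auto intro!: winds_nonvanishing)
next
  case (insert k K)
  then show ?case using winds_mult[OF assms(1,2), of "\<phi> k" "d k"] by simp
qed

text \<open>\<open>F / E\<close> on \<open>closure V\<close> and \<open>(z - b) powi (d - e)\<close>
  off \<open>V\<close> agree on \<open>frontier V\<close>. Together they form a zero-free function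
  on the plane. It has a logarithm, so the power has one on a large circle.\<close>

lemma winds_unique:
  assumes V: "open V" "bounded V" "b \<in> V" and "winds V b \<phi> d" "winds V b \<phi> e"
  shows "d = e"
proof -
  obtain E where E: "continuous_on (closure V) E" "\<And>z. z \<in> closure V \<Longrightarrow> E z \<noteq> 0"
      "\<And>z. z \<in> frontier V \<Longrightarrow> \<phi> z = (z - b) powi d * E z"
    using assms(4) by (rule windsE) blast
  obtain F where F: "continuous_on (closure V) F" "\<And>z. z \<in> closure V \<Longrightarrow> F z \<noteq> 0"
      "\<And>z. z \<in> frontier V \<Longrightarrow> \<phi> z = (z - b) powi e * F z"
    using assms(5) by (rule windsE) blast
  define G where "G = (\<lambda>z. if z \<in> closure V then F z / E z else (z - b) powi (d - e))"
  have out: "G z = (z - b) powi (d - e)" if "z \<notin> V" for z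
  proof (cases "z \<in> closure V")
    case True
    then have z: "z \<in> frontier V" using that V by (auto simp: frontier_def interior_open)
    have "z \<noteq> b" using that V by auto
    then have "(z - b) powi (d - e) * E z = F z"
      using E(3)[OF z] F(3)[OF z] by (simp add: power_int_diff divide_eq_eq mult.commute)
    then show ?thesis using E(2)[OF True] True by (simp add: G_def divide_eq_eq)
  qed (simp add: G_def)
  have "continuous_on (closure V \<union> - V) G"
  proof (rule continuous_on_closed_Un)
    show "continuous_on (closure V) G"
      by (rule continuous_on_eq[OF continuous_on_divide[OF F(1) E(1)]])
        (use E in \<open>auto simp: G_def\<close>)
    show "continuous_on (- V) G"
      by (rule continuous_on_eq[of _ "\<lambda>z. (z - b) powi (d - e)"])
        (use V out in \<open>auto intro!: continuous_intros\<close>)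
  qed (use V in \<open>auto simp: closed_Compl\<close>)
  moreover have "closure V \<union> - V = UNIV" using closure_subset by blast
  ultimately have cG: "continuous_on UNIV G" by simp
  have "G z \<noteq> 0" for z
    using E(2) F(2) V(3) closure_subset[of V] by (cases "z \<in> closure V") (auto simp: G_def)
  then obtain h where h: "continuous_on UNIV h" "\<And>z. G z = exp (h z)"
    using continuous_logarithm_on_contractible[OF cG contractible_UNIV] by auto
  obtain R where R: "R > 0" "V \<subseteq> ball b R"
    using V bounded_subset_ballD[of V b] by blast
  have "d - e = 0"
  proof (rule power_int_log_on_circle[OF R(1)])
    show "continuous_on (sphere b R) h" using h continuous_on_subset by blast
    show "(z - b) powi (d - e) = exp (h z)" if "z \<in> sphere b R" for z
      using out[of z] h that R(2) by fastforce
  qed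
  then show ?thesis by simp
qed

text \<open>As \<open>V\<close> is connected and avoids its frontier, \<open>b\<close> and
  \<open>c\<close> lie in one component of the complement of \<open>frontier V\<close>, and
  \<open>log_ratio\<close> applies.\<close>

lemma winds_linear:
  assumes "open V" "connected V" "b \<in> V" "c \<in> V"
  shows "winds V b (\<lambda>z. z - c) 1"
proof -
  have "V \<subseteq> - frontier V" using assms(1) by (auto simp: frontier_def interior_open)
  then have "connected_component (- frontier V) c b"
    using assms unfolding connected_component_def by blast
  then obtain h where h: "continuous_on (frontier V) h" "\<forall>z\<in>frontier V. z - c = (z - b) * exp (h z)"
    using log_ratio[OF frontier_closed] by blast
  have "winds V b (\<lambda>z. (z - b) * exp (h z)) (1 + 0)"
    by (rule winds_mult[OF assms(1,3) _ winds_exp[OF h(1)]])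
      (auto simp: winds_def intro!: exI[of _ "\<lambda>_. 1"])
  then show ?thesis using h by (auto elim!: winds_cong)
qed

lemma complex_poly_induct [consumes 1, case_names const linear]:
  fixes p :: "complex poly"
  assumes "p \<noteq> 0" "\<And>c. c \<noteq> 0 \<Longrightarrow> P [:c:]"
    "\<And>c q. q \<noteq> 0 \<Longrightarrow> P q \<Longrightarrow> P ([:-c, 1:] * q)"
  shows "P p"
  using assms(1)
proof (induction "degree p" arbitrary: p)
  case 0
  then obtain c where "p = [:c:]" using degree_eq_zeroE by metis
  then show ?case using 0 assms(2) by auto
next
  case (Suc n)
  then have "\<not> constant (poly p)" by (simp add: constant_degree)
  then obtain c where "poly p c = 0" using fundamental_theorem_of_algebra by blast
  then obtain q where q: "p = [:-c, 1:] * q" using poly_eq_0_iff_dvd by (metis dvdE)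
  with Suc have "q \<noteq> 0" by auto
  then have "degree p = Suc (degree q)" unfolding q by (subst degree_mult_eq) auto
  then show ?case using Suc \<open>q \<noteq> 0\<close> q assms(3) by auto
qed

text \<open>A root in \<open>V\<close> adds \<open>1\<close> to the index, a root off
  \<open>closure V\<close> adds \<open>0\<close>. The set counts roots without multiplicity, hence
  only an inequality.\<close>

lemma winds_poly:
  fixes p :: "complex poly"
  assumes V: "open V" "connected V" "b \<in> V" and "p \<noteq> 0" "\<And>z. z \<in> frontier V \<Longrightarrow> poly p z \<noteq> 0"
  shows "\<exists>n::nat. winds V b (poly p) (int n) \<and> card {z\<in>V. poly p z = 0} \<le> n"
  using assms(4,5)
proof (induction p rule: complex_poly_induct)
  case (const c)
  then show ?case by (intro exI[of _ 0]) (auto intro!: winds_nonvanishing)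
next
  case (linear c q)
  then obtain n where n: "winds V b (poly q) (int n)" "card {z\<in>V. poly q z = 0} \<le> n" by auto
  have fin: "finite {z\<in>V. poly q z = 0}" using poly_roots_finite[OF \<open>q \<noteq> 0\<close>] by simp
  have c: "c \<notin> frontier V" using linear(3)[of c] by auto
  have eq: "poly ([:-c, 1:] * q) z = (z - c) * poly q z" for z
    by (simp add: algebra_simps del: mult_pCons_left)
  show ?case
  proof (cases "c \<in> V")
    case True
    have "{z\<in>V. poly ([:-c, 1:] * q) z = 0} = insert c {z\<in>V. poly q z = 0}"
      using True unfolding eq by auto
    then have "card {z\<in>V. poly ([:-c, 1:] * q) z = 0} \<le> Suc n"
      using card_insert_le_m1 n(2) fin by (simp add: card_insert_if)
    moreover have "winds V b (poly ([:-c, 1:] * q)) (1 + int n)"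
      using winds_mult[OF V(1,3) winds_linear[OF V True] n(1)]
      by (rule winds_cong) (rule eq)
    ultimately show ?thesis by (metis of_nat_Suc)
  next
    case False
    then have "c \<notin> closure V" using c V by (auto simp: frontier_def interior_open)
    then have "winds V b (\<lambda>z. z - c) 0"
      by (intro winds_nonvanishing continuous_intros) auto
    then have "winds V b (poly ([:-c, 1:] * q)) (0 + int n)"
      by (rule winds_cong[OF winds_mult[OF V(1,3) _ n(1)] eq])
    moreover have "{z\<in>V. poly ([:-c, 1:] * q) z = 0} = {z\<in>V. poly q z = 0}"
      using False unfolding eq by auto
    ultimately show ?thesis using n by (metis add_0)
  qed
qed

section \<open>Factorization of zero-free functions on compact plane sets\<close>

text \<open>Lifting \<open>F\<close> through \<open>u \<mapsto> k + exp u\<close>, a logarithm on a half plane grows by \<open>2 * pi * r * \<i>\<close> under the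
  period of \<open>exp\<close>; after subtracting \<open>r * u\<close> it descends to the circle.\<close>
lemma circle_index:
  fixes k :: complex and F :: "complex \<Rightarrow> complex"
  assumes "\<epsilon> > 0" "continuous_on (cball k \<epsilon> - {k}) F" "\<And>z. z \<in> cball k \<epsilon> - {k} \<Longrightarrow> F z \<noteq> 0"
  shows "\<exists>(r::int) \<eta>. continuous_on (sphere k \<epsilon>) \<eta> \<and>
           (\<forall>z\<in>sphere k \<epsilon>. F z = (z - k) powi r * exp (\<eta> z))"
proof -
  \<comment> \<open>The map \<open>u \<mapsto> k + exp u\<close> sends this half plane onto the
    punctured closed disc.\<close>
  define A where "A = {u. Re u \<le> ln \<epsilon>}"
  have cA: "convex A" unfolding A_def by (rule convex_halfspace_Re_le)
  have in_ball: "k + exp u \<in> cball k \<epsilon> - {k}" if "u \<in> A" for u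
  proof -
    have "exp (Re u) \<le> exp (ln \<epsilon>)" using that unfolding A_def by simp
    then show ?thesis using assms(1) by (simp add: dist_norm norm_exp_eq_Re)
  qed
  have "continuous_on A (\<lambda>u. k + exp u)" by (intro continuous_intros)
  then have "continuous_on A (\<lambda>u. F (k + exp u))"
    by (rule continuous_on_compose2[OF assms(2)]) (use in_ball in auto)
  then obtain \<phi> where \<phi>: "continuous_on A \<phi>" "\<And>u. u \<in> A \<Longrightarrow> F (k + exp u) = exp (\<phi> u)"
    by (rule continuous_logarithm_on_contractible[OF _ convex_imp_contractible[OF cA]])
      (use in_ball assms(3) in auto)
  have shift: "u + 2 * of_real pi * \<i> \<in> A" if "u \<in> A" for u using that by (simp add: A_def)
  have "continuous_on A (\<lambda>u. u + 2 * of_real pi * \<i>)" by (intro continuous_intros)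
  then have "continuous_on A (\<lambda>u. \<phi> (u + 2 * of_real pi * \<i>))"
    by (rule continuous_on_compose2[OF \<phi>(1)]) (use shift in auto)
  then have "continuous_on A (\<lambda>u. \<phi> (u + 2 * of_real pi * \<i>) - \<phi> u)"
    using \<phi>(1) by (rule continuous_on_diff)
  moreover have "exp (\<phi> (u + 2 * of_real pi * \<i>) - \<phi> u) = 1" if "u \<in> A" for u
    using \<phi>(2)[OF that] \<phi>(2)[OF shift[OF that]]
    by (simp add: exp_diff) (simp add: exp_add)
  ultimately obtain r::int where r: "\<And>u. u \<in> A \<Longrightarrow> \<phi> (u + 2 * of_real pi * \<i>) - \<phi> u = 2 * pi * r * \<i>"
    using exp_eq_one_const[OF convex_connected[OF cA]] by blast
  define \<xi> where "\<xi> = (\<lambda>u. \<phi> u - of_int r * u)"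
  have per: "\<xi> (u + 2 * of_real pi * \<i>) = \<xi> u" if "u \<in> A" for u
    using r[OF that] by (simp add: \<xi>_def algebra_simps)
  have c\<xi>: "continuous_on A \<xi>" unfolding \<xi>_def by (intro continuous_intros \<phi>)
  \<comment> \<open>\<open>Ln\<close> jumps by the period of \<open>\<xi>\<close> across the
    negative axis, so the composite has no jump.\<close>
  define \<eta> where "\<eta> = (\<lambda>z. \<xi> (Ln (z - k)))"
  have LnA: "Ln v \<in> A" if "norm v = \<epsilon>" for v
    using that assms(1) by (auto simp: A_def)
  have eq: "\<xi> (Ln (- v) + \<i> * of_real pi) = \<xi> (Ln v)" if v: "norm v = \<epsilon>" for v
  proof -
    have "v \<noteq> 0" using v assms(1) by auto
    then have "Ln (- v) + \<i> * of_real pi = Ln v + 2 * of_real pi * \<i> \<or> Ln (- v) + \<i> * of_real pi = Ln v"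
      by (auto simp: Ln_minus)
    then show ?thesis using per[OF LnA[OF v]] by presburger
  qed
  have n: "norm (z - k) = \<epsilon>" if "z \<in> sphere k \<epsilon>" for z
    using that by (simp add: dist_norm norm_minus_commute)
  \<comment> \<open>On the left half circle \<open>Ln (- (z - k)) + \<i> * pi\<close> is a
    continuous logarithm of \<open>z - k\<close>; by \<open>eq\<close> it yields the same
    \<open>\<eta>\<close>.\<close>
  let ?P = "sphere k \<epsilon> \<inter> {z. Re z \<ge> Re k}" and ?N = "sphere k \<epsilon> \<inter> {z. Re z \<le> Re k}"
  have "continuous_on (?P \<union> ?N) \<eta>"
  proof (rule continuous_on_closed_Un)
    have nz: "z - k \<noteq> 0" if "z \<in> sphere k \<epsilon>" for z
      using n[OF that] assms(1) by auto
    have "z - k \<notin> \<real>\<^sub>\<le>\<^sub>0" if "z \<in> ?P" for z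
      using that nz[of z] by (auto simp: complex_nonpos_Reals_iff complex_eq_iff)
    then have "continuous_on ?P (\<lambda>z. Ln (z - k))"
      by (intro continuous_on_Ln' continuous_on_diff continuous_on_id continuous_on_const)
    then show "continuous_on ?P \<eta>"
      unfolding \<eta>_def by (rule continuous_on_compose2[OF c\<xi>]) (use n LnA in auto)
    have "- (z - k) \<notin> \<real>\<^sub>\<le>\<^sub>0" if "z \<in> ?N" for z
      using that nz[of z] by (auto simp: complex_nonpos_Reals_iff complex_eq_iff)
    then have "continuous_on ?N (\<lambda>z. Ln (- (z - k)) + \<i> * of_real pi)"
      by (intro continuous_on_add continuous_on_Ln' continuous_on_minus continuous_on_diff
          continuous_on_id continuous_on_const)
    moreover have "Ln (- (z - k)) + \<i> * of_real pi \<in> A" if "z \<in> ?N" for z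
    proof -
      have "Ln (- (z - k)) \<in> A" by (rule LnA) (use n[of z] that in \<open>simp add: norm_minus_commute\<close>)
      then show ?thesis by (simp add: A_def)
    qed
    ultimately have "continuous_on ?N (\<lambda>z. \<xi> (Ln (- (z - k)) + \<i> * of_real pi))"
      by (intro continuous_on_compose2[OF c\<xi>]) auto
    then show "continuous_on ?N \<eta>"
      by (rule continuous_on_eq) (use eq[OF n] in \<open>simp add: \<eta>_def\<close>)
  qed (auto intro!: closed_Int closed_halfspace_Re_ge closed_halfspace_Re_le)
  moreover have "?P \<union> ?N = sphere k \<epsilon>" by auto
  ultimately have "continuous_on (sphere k \<epsilon>) \<eta>" by simp
  moreover have "F z = (z - k) powi r * exp (\<eta> z)" if z: "z \<in> sphere k \<epsilon>" for z
  proof -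
    have nz: "z - k \<noteq> 0" using n[OF z] assms(1) by auto
    have "F z = exp (\<phi> (Ln (z - k)))"
      using \<phi>(2)[OF LnA[OF n[OF z]]] nz by simp
    also have "\<phi> (Ln (z - k)) = of_int r * Ln (z - k) + \<eta> z" by (simp add: \<eta>_def \<xi>_def)
    also have "exp \<dots> = exp (Ln (z - k)) powi r * exp (\<eta> z)"
      by (simp only: exp_add exp_power_int)
    finally show ?thesis using nz by simp
  qed
  ultimately show ?thesis by (intro exI[of _ r] exI[of _ \<eta>]) auto
qed

text \<open>After division by a power of \<open>z - k\<close>, the function is an exponential on a
  small circle about \<open>k\<close>, and Tietze extends its exponent over the disc. The disc
  avoids \<open>S\<close>, so on \<open>S\<close> only the power is split off.\<close>

lemma fill_puncture:
  fixes F :: "complex \<Rightarrow> complex"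
  assumes "finite K" "k \<notin> K" "compact S" "S \<inter> insert k K = {}"
    and F: "continuous_on (- insert k K) F" "\<And>z. z \<notin> insert k K \<Longrightarrow> F z \<noteq> 0"
  shows "\<exists>(r::int) G. continuous_on (- K) G \<and> (\<forall>z. z \<notin> K \<longrightarrow> G z \<noteq> 0) \<and>
     (\<forall>z\<in>S. F z = (z - k) powi r * G z)"
proof -
  have "open (- (S \<union> K))"
    using assms by (intro open_Compl closed_Un finite_imp_closed compact_imp_closed)
  moreover have "k \<in> - (S \<union> K)" using assms by auto
  ultimately obtain \<epsilon> where \<epsilon>: "\<epsilon> > 0" "cball k \<epsilon> \<subseteq> - (S \<union> K)"
    using open_contains_cball by blast
  have "continuous_on (cball k \<epsilon> - {k}) F"
    by (rule continuous_on_subset[OF F(1)]) (use \<epsilon> in auto)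
  moreover have "F z \<noteq> 0" if "z \<in> cball k \<epsilon> - {k}" for z
    using that \<epsilon> F(2) by blast
  ultimately obtain r::int and \<eta> where \<eta>: "continuous_on (sphere k \<epsilon>) \<eta>"
      "\<And>z. z \<in> sphere k \<epsilon> \<Longrightarrow> F z = (z - k) powi r * exp (\<eta> z)"
    using circle_index[OF \<epsilon>(1)] by blast
  obtain \<zeta> where \<zeta>: "continuous_on (cball k \<epsilon>) \<zeta>" "\<And>z. z \<in> sphere k \<epsilon> \<Longrightarrow> \<zeta> z = \<eta> z"
    using Tietze_unbounded[OF \<eta>(1), of "cball k \<epsilon>"] closed_subset[OF sphere_cball closed_sphere]
    by blast
  define G where "G = (\<lambda>z. if z \<in> cball k \<epsilon> then exp (\<zeta> z) else F z / (z - k) powi r)"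
  let ?T = "- K - ball k \<epsilon>"
  have un: "cball k \<epsilon> \<union> ?T = - K" using \<epsilon> by auto
  have "continuous_on (cball k \<epsilon> \<union> ?T) G" unfolding G_def
  proof (rule continuous_on_cases_local)
    show "closedin (top_of_set (cball k \<epsilon> \<union> ?T)) (cball k \<epsilon>)"
      by (rule closed_subset) auto
    have "closedin (top_of_set (- K)) (- K \<inter> (- ball k \<epsilon>))"
      by (intro closedin_closed_Int closed_Compl open_ball)
    then show "closedin (top_of_set (cball k \<epsilon> \<union> ?T)) ?T"
      unfolding un by (simp add: Diff_eq)
    show "continuous_on (cball k \<epsilon>) (\<lambda>z. exp (\<zeta> z))" by (intro continuous_intros \<zeta>)
    show "continuous_on ?T (\<lambda>z. F z / (z - k) powi r)"
    proof (intro continuous_intros continuous_on_subset[OF F(1)])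
      show "?T \<subseteq> - insert k K" using \<epsilon> by auto
    qed (use \<epsilon> in auto)
    fix z assume "z \<in> cball k \<epsilon> \<and> z \<notin> cball k \<epsilon> \<or> z \<in> ?T \<and> z \<in> cball k \<epsilon>"
    then have z: "z \<in> sphere k \<epsilon>" by auto
    then have "z \<noteq> k" using \<epsilon> by auto
    then show "exp (\<zeta> z) = F z / (z - k) powi r" using \<zeta>(2)[OF z] \<eta>(2)[OF z] by simp
  qed
  then have "continuous_on (- K) G" by (simp only: un)
  moreover have "G z \<noteq> 0" if "z \<notin> K" for z
    using that F(2)[of z] \<epsilon>(1) by (cases "z = k") (auto simp: G_def)
  moreover have "F z = (z - k) powi r * G z" if "z \<in> S" for z
  proof -
    have "z \<noteq> k" "z \<notin> cball k \<epsilon>" using that \<epsilon> assms by auto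
    then show ?thesis by (simp add: G_def)
  qed
  ultimately show ?thesis by (intro exI[of _ r] exI[of _ G]) auto
qed

text \<open>Filling the punctures one by one ends with a zero-free function on the plane, which has
  a logarithm.\<close>

lemma punctured_plane_factorization:
  fixes F :: "complex \<Rightarrow> complex"
  assumes "finite K" "compact S" "S \<inter> K = {}"
    and "continuous_on (- K) F" "\<And>z. z \<notin> K \<Longrightarrow> F z \<noteq> 0"
  shows "\<exists>(r::complex \<Rightarrow> int) h. continuous_on S h \<and>
     (\<forall>z\<in>S. F z = exp (h z) * (\<Prod>k\<in>K. (z - k) powi r k))"
  using assms
proof (induction K arbitrary: F rule: finite_induct)
  case empty
  then have "continuous_on UNIV F" "\<And>z. F z \<noteq> 0" by auto
  then obtain h where "continuous_on UNIV h" "\<And>z. F z = exp (h z)"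
    using continuous_logarithm_on_contractible[OF _ contractible_UNIV, of F] by auto
  then show ?case by (auto intro!: exI[of _ h] continuous_on_subset[of UNIV h S])
next
  case (insert k K)
  obtain m::int and G where G: "continuous_on (- K) G" "\<And>z. z \<notin> K \<Longrightarrow> G z \<noteq> 0"
     "\<And>z. z \<in> S \<Longrightarrow> F z = (z - k) powi m * G z"
    using fill_puncture[OF insert.hyps insert.prems] by auto
  obtain r :: "complex \<Rightarrow> int" and h where h: "continuous_on S h"
    "\<And>z. z \<in> S \<Longrightarrow> G z = exp (h z) * (\<Prod>k\<in>K. (z - k) powi r k)"
    using insert.IH[OF insert.prems(1) _ G(1,2)] insert.prems(2) by blast
  have "(\<Prod>j\<in>K. (z - j) powi (r(k := m)) j) = (\<Prod>j\<in>K. (z - j) powi r j)" for z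
    using insert.hyps by (intro prod.cong) auto
  then have "F z = exp (h z) * (\<Prod>j\<in>insert k K. (z - j) powi (r(k := m)) j)" if "z \<in> S" for z
    using G(3)[OF that] h(2)[OF that] insert.hyps by simp
  then show ?case using h(1) by (intro exI[of _ "r(k := m)"] exI[of _ h]) auto
qed

text \<open>This is Eilenberg's factorization. The part \<open>sgn (\<phi> z)\<close> extends to the
  plane minus finitely many points as a map into the circle; the modulus is the exponential of a
  real function.\<close>

lemma compact_plane_factorization:
  fixes \<phi> :: "complex \<Rightarrow> complex"
  assumes "compact S" "continuous_on S \<phi>" "\<And>z. z \<in> S \<Longrightarrow> \<phi> z \<noteq> 0"
  shows "\<exists>K (r::complex \<Rightarrow> int) h. finite K \<and> S \<inter> K = {} \<and> continuous_on S h \<and>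
     (\<forall>z\<in>S. \<phi> z = exp (h z) * (\<Prod>k\<in>K. (z - k) powi r k))"
proof -
  have "continuous_on S (\<lambda>z. sgn (\<phi> z))"
    unfolding sgn_div_norm using assms by (intro continuous_intros) auto
  \<comment> \<open>\<open>rel_frontier (cball 0 1)\<close> is the unit circle, in the form that the
    extension theorem expects.\<close>
  moreover have "(\<lambda>z. sgn (\<phi> z)) \<in> S \<rightarrow> rel_frontier (cball 0 1)"
    using assms(3) by (auto simp: norm_sgn)
  ultimately obtain K g where K: "finite K" "disjnt K S" "continuous_on (UNIV - K) g"
     "g \<in> (UNIV - K) \<rightarrow> rel_frontier (cball 0 1)" "\<And>z. z \<in> S \<Longrightarrow> g z = sgn (\<phi> z)"
    using extend_map_affine_to_sphere_cofinite_simple[of S "cball (0::complex) 1" UNIV "\<lambda>z. sgn (\<phi> z)"]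
    assms(1) by (auto simp: aff_dim_cball)
  have g: "norm (g z) = 1" if "z \<notin> K" for z
    using K(4) that by (auto simp: Pi_iff)
  then have g0: "g z \<noteq> 0" if "z \<notin> K" for z using that by force
  obtain r :: "complex \<Rightarrow> int" and h where h: "continuous_on S h"
    "\<And>z. z \<in> S \<Longrightarrow> g z = exp (h z) * (\<Prod>k\<in>K. (z - k) powi r k)"
    using punctured_plane_factorization[OF K(1) assms(1), of g] K(2,3) g0
    by (auto simp: Compl_eq_Diff_UNIV disjnt_def Int_commute)
  have "\<phi> z = exp (h z + of_real (ln (norm (\<phi> z)))) * (\<Prod>k\<in>K. (z - k) powi r k)" if z: "z \<in> S" for z
  proof -
    have "\<phi> z = sgn (\<phi> z) * of_real (norm (\<phi> z))" using assms(3)[OF z] by (simp add: sgn_eq)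
    then show ?thesis using h(2)[OF z] K(5)[OF z] assms(3)[OF z]
      by (simp add: exp_add exp_of_real ac_simps)
  qed
  moreover have "continuous_on S (\<lambda>z. h z + of_real (ln (norm (\<phi> z))))"
    using assms by (intro continuous_intros h) auto
  ultimately show ?thesis using K(1,2) unfolding disjnt_def Int_commute[of K]
    by (intro exI[of _ K] exI[of _ r] exI[of _ "\<lambda>z. h z + of_real (ln (norm (\<phi> z)))"]) auto
qed

section \<open>Injectivity from the frontier to the closure\<close>

text \<open>As in Rouche's theorem, the hypothesis puts \<open>q z / p z\<close> in the disc of
  radius \<open>1\<close> about \<open>1\<close>, where \<open>Ln\<close> is continuous.\<close>

lemma log_near:
  fixes p q :: "complex \<Rightarrow> complex"
  assumes "continuous_on S p" "continuous_on S q" "\<And>z. z \<in> S \<Longrightarrow> norm (p z - q z) < norm (p z)"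
  shows "\<exists>h. continuous_on S h \<and> (\<forall>z\<in>S. q z \<noteq> 0 \<and> p z = q z * exp (h z))"
proof -
  have re: "Re (q z / p z) > 0" if z: "z \<in> S" for z
  proof -
    have p: "p z \<noteq> 0" using assms(3)[OF z] by auto
    have "norm (1 - q z / p z) = norm (p z - q z) / norm (p z)"
      using p by (simp add: diff_divide_eq_iff flip: norm_divide)
    then have "norm (1 - q z / p z) < 1" using assms(3)[OF z] p by simp
    then have "\<bar>Re (1 - q z / p z)\<bar> < 1" using abs_Re_le_cmod le_less_trans by blast
    then show ?thesis by simp
  qed
  have nz: "p z \<noteq> 0" "q z \<noteq> 0" if "z \<in> S" for z using re[OF that] by auto
  have "continuous_on S (\<lambda>z. q z / p z)" by (intro continuous_intros assms) (use nz in auto)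
  then have "continuous_on S (\<lambda>z. - Ln (q z / p z))"
    by (intro continuous_on_minus continuous_on_Ln')
      (use re in \<open>auto simp: complex_nonpos_Reals_iff simp del: Re_divide\<close>, use re in force)
  moreover have "p z = q z * exp (- Ln (q z / p z))" if "z \<in> S" for z
    using nz[OF that] by (simp add: exp_minus)
  ultimately show ?thesis using nz by (intro exI[of _ "\<lambda>z. - Ln (q z / p z)"]) auto
qed

text \<open>The common setting of the three conditions, which differ in the choice of
  \<open>V\<close> and in the reason why the values on \<open>V\<close> off \<open>L\<close> share a
  component of \<open>- L\<close>.\<close>

locale frontier_injective =
  fixes V :: "complex set" and g :: "complex \<Rightarrow> complex"
  assumes V: "open V" "connected V" "bounded V"
    and cont: "continuous_on (closure V) g"
    and hol: "g holomorphic_on V"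
    and approx: "\<And>e. e > 0 \<Longrightarrow> \<exists>p. \<forall>z\<in>closure V. norm (g z - poly p z) < e"
    and inj: "inj_on g (frontier V)"
begin

abbreviation L where "L \<equiv> g ` frontier V"

lemma frontier_disj: "z \<in> frontier V \<Longrightarrow> z \<notin> V"
  using V by (auto simp: frontier_def interior_open)

lemma frontier_subset_closure: "frontier V \<subseteq> closure V"
  by (simp add: frontier_def)

lemma closure_cases: "z \<in> closure V \<Longrightarrow> z \<in> V \<or> z \<in> frontier V"
  using V by (auto simp: frontier_def interior_open)

lemma compact_frontier: "compact (frontier V)"
  using V(3) by (simp add: compact_frontier_bounded)

lemma cont_frontier: "continuous_on (frontier V) g"
  using cont frontier_subset_closure continuous_on_subset by blast

lemma compact_L: "compact L"
  using compact_continuous_image[OF cont_frontier compact_frontier] .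

lemma continuous_inverse:
  obtains \<psi> where "continuous_on L \<psi>" "\<And>z. z \<in> frontier V \<Longrightarrow> \<psi> (g z) = z"
    "\<And>u. u \<in> L \<Longrightarrow> \<psi> u \<in> frontier V \<and> g (\<psi> u) = u"
proof
  let ?\<psi> = "the_inv_into (frontier V) g"
  show "?\<psi> (g z) = z" if "z \<in> frontier V" for z by (rule the_inv_into_f_f[OF inj that])
  then show "continuous_on L ?\<psi>"
    by (intro continuous_on_inv[OF cont_frontier compact_frontier]) auto
  show "?\<psi> u \<in> frontier V \<and> g (?\<psi> u) = u" if "u \<in> L" for u
    using the_inv_into_into[OF inj that] f_the_inv_into_f[OF inj that] by auto
qed

text \<open>A polynomial close to \<open>g - w\<close> is corrected to vanish exactly at
  \<open>a\<close> and \<open>b\<close>, and \<open>log_near\<close> compares it with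
  \<open>g - w\<close> on the frontier. Two prescribed zeros suffice to detect a double
  value.\<close>

lemma poly_factor:
  assumes "w \<notin> L" "a \<in> closure V" "b \<in> closure V" "g a = w" "g b = w"
  shows "\<exists>q h. poly q a = 0 \<and> poly q b = 0 \<and> continuous_on (frontier V) h \<and>
     (\<forall>z\<in>frontier V. poly q z \<noteq> 0 \<and> g z - w = poly q z * exp (h z))"
proof -
  \<comment> \<open>The empty case is separate because \<open>setdist\<close> to an empty set is
    \<open>0\<close>.\<close>
  obtain \<delta> where \<delta>: "\<delta> > 0" "\<And>z. z \<in> frontier V \<Longrightarrow> \<delta> \<le> norm (g z - w)"
  proof (cases "L = {}")
    case True
    then show ?thesis using that[of 1] by auto
  next
    case False
    then have "setdist {w} L > 0"
      using setdist_gt_0_compact_closed[of "{w}" L] compact_imp_closed[OF compact_L] assms(1) by auto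
    moreover have "setdist {w} L \<le> norm (g z - w)" if "z \<in> frontier V" for z
      using setdist_le_dist[of w "{w}" "g z" L] that by (simp add: dist_norm norm_minus_commute)
    ultimately show ?thesis using that by blast
  qed
  obtain B where B: "B > 0" "\<And>z. z \<in> closure V \<Longrightarrow> norm z \<le> B"
    using V(3) bounded_closure bounded_pos by metis
  \<comment> \<open>Chosen so that, with \<open>e = \<delta> / (2 * C)\<close>, the error bounds add
    up to \<open>e + e + (C - 1) * 2 * e = \<delta>\<close>.\<close>
  define C where "C = (if a = b then 1 else 2 + 4 * B / norm (b - a))"
  have C1: "C \<ge> 1" using B(1) by (auto simp: C_def)
  obtain p where p: "\<And>z. z \<in> closure V \<Longrightarrow> norm (g z - poly p z) < \<delta> / (2 * C)"
    using approx[of "\<delta> / (2 * C)"] \<delta>(1) C1 by auto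
  define e where "e = \<delta> / (2 * C)"
  have e: "e > 0" "e * (2 * C) = \<delta>" using \<delta>(1) C1 by (auto simp: e_def)
  define s where "s = (poly p b - poly p a) / (b - a)"
  text \<open>Subtracting the line through the two values makes both zeros exact; the correction is
    small on \<open>closure V\<close>. For \<open>a = b\<close> the slope is \<open>x / 0 = 0\<close>.\<close>
  define q where "q = p - [:poly p a - s * a, s:]"
  have "poly q a = 0" by (simp add: q_def)
  have "s * (b - a) = poly p b - poly p a" by (simp add: s_def)
  then have "poly q b = 0" by (simp add: q_def algebra_simps)
  have pa: "norm (poly p a - w) < e" and pb: "norm (poly p b - w) < e"
    using p[OF assms(2)] p[OF assms(3)] assms(4,5) by (auto simp: norm_minus_commute e_def)
  have small: "norm (g z - w - poly q z) < norm (g z - w)" if z: "z \<in> frontier V" for z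
  proof -
    have zc: "z \<in> closure V" using z frontier_subset_closure by blast
    have line: "norm (s * (z - a)) \<le> (C - 1) * 2 * e - (if a = b then 0 else 2 * e)"
    proof (cases "a = b")
      case False
      have "norm (poly p b - poly p a) \<le> 2 * e"
        using norm_triangle_ineq4[of "poly p b - w" "poly p a - w"] pa pb by simp
      moreover have "norm (z - a) \<le> 2 * B"
        using norm_triangle_ineq4[of z a] B(2)[OF zc] B(2)[OF assms(2)] by simp
      ultimately have "norm (poly p b - poly p a) * norm (z - a) \<le> (2 * e) * (2 * B)"
        using e(1) by (intro mult_mono) auto
      then have "norm (s * (z - a)) \<le> 4 * e * B / norm (b - a)"
        by (simp add: s_def norm_mult norm_divide divide_right_mono)
      also have "\<dots> \<le> (C - 1) * 2 * e - 2 * e"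
        using False B(1) e(1) by (simp add: C_def field_simps)
      finally show ?thesis using False by simp
    qed (simp add: s_def C_def)
    have "g z - w - poly q z = (g z - poly p z) + ((poly p a - w) + s * (z - a))"
      by (simp add: q_def algebra_simps)
    then have "norm (g z - w - poly q z) \<le> norm (g z - poly p z) + (norm (poly p a - w) + norm (s * (z - a)))"
      by (metis (no_types, lifting) add_left_mono norm_triangle_ineq order_trans)
    also have "\<dots> < e + (e + (C - 1) * 2 * e)"
      using p[OF zc] pa line e(1) unfolding e_def[symmetric] by (auto split: if_splits)
    also have "\<dots> = \<delta>" using e(2) by (simp add: algebra_simps)
    finally show ?thesis using \<delta>(2)[OF z] by linarith
  qed
  have "continuous_on (frontier V) (\<lambda>z. g z - w)" "continuous_on (frontier V) (poly q)"
    by (intro continuous_intros cont_frontier)+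
  from log_near[OF this small] show ?thesis
    using \<open>poly q a = 0\<close> \<open>poly q b = 0\<close> by (intro exI[of _ q]) auto
qed

text \<open>The polynomial from \<open>poly_factor\<close> has the same index as
  \<open>g - w\<close> and vanishes at \<open>a\<close> and \<open>b\<close>. Taking
  \<open>a = b\<close> shows that the index is positive for a value attained on
  \<open>V\<close>.\<close>

lemma index_ge_zeros:
  assumes "c \<in> V" "w \<notin> L" "a \<in> V" "b \<in> V" "g a = w" "g b = w"
  shows "\<exists>n::nat. winds V c (\<lambda>z. g z - w) (int n) \<and> card {a, b} \<le> n"
proof -
  have "a \<in> closure V" "b \<in> closure V" using assms closure_subset by auto
  then obtain q h where q: "poly q a = 0" "poly q b = 0" "continuous_on (frontier V) h"
     "\<And>z. z \<in> frontier V \<Longrightarrow> poly q z \<noteq> 0"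
     "\<And>z. z \<in> frontier V \<Longrightarrow> g z - w = poly q z * exp (h z)"
    using poly_factor[OF assms(2) _ _ assms(5,6)] by blast
  have "frontier V \<noteq> {}" using assms(3) V(3) by (auto simp: frontier_eq_empty)
  then have "q \<noteq> 0" using q(4) by fastforce
  then obtain n where n: "winds V c (poly q) (int n)" "card {z\<in>V. poly q z = 0} \<le> n"
    using winds_poly[OF V(1,2) assms(1) _ q(4)] by blast
  have "card {a, b} \<le> card {z\<in>V. poly q z = 0}"
    using poly_roots_finite[OF \<open>q \<noteq> 0\<close>] q(1,2) assms(3,4) by (intro card_mono) auto
  moreover have "winds V c (\<lambda>z. g z - w) (int n + 0)"
    by (rule winds_cong[OF winds_mult[OF V(1) assms(1) n(1) winds_exp[OF q(3)]] q(5)])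
  ultimately show ?thesis using n(2) by auto
qed

text \<open>For \<open>g a\<close> outside \<open>L\<close>, the function \<open>g - g a\<close>
  would have a logarithm on the frontier and thus index \<open>0\<close>, against its zero at
  \<open>a\<close>.\<close>

lemma image_inside:
  assumes "a \<in> V" "g a \<notin> L"
  shows "g a \<in> inside L"
proof (rule ccontr)
  assume "g a \<notin> inside L"
  then have "g a \<in> outside L" using assms(2) by (simp add: outside_inside)
  then obtain h where h: "continuous_on L h" "\<And>u. u \<in> L \<Longrightarrow> u - g a = exp (h u)"
    using log_outside[OF compact_L] by blast
  have "continuous_on (frontier V) (\<lambda>z. h (g z))"
    by (rule continuous_on_compose2[OF h(1) cont_frontier]) auto
  then have "winds V a (\<lambda>z. g z - g a) 0"
    by (rule winds_cong[OF winds_exp]) (use h in auto)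
  moreover obtain n where "winds V a (\<lambda>z. g z - g a) (int n)" "card {a, a} \<le> n"
    using index_ge_zeros[OF assms(1,2,1,1)] by auto
  ultimately show False using winds_unique[OF V(1,3) assms(1)] by fastforce
qed

text \<open>Expressing \<open>\<psi> u - a\<close>, for the inverse \<open>\<psi>\<close> of \<open>g\<close>, through factors \<open>u - k\<close> and pulling back
  along \<open>g\<close>, the index \<open>1\<close> of \<open>z - a\<close> becomes a combination of the indices of \<open>g - k\<close>, all of
  which are multiples of the index of \<open>g - w\<close>.\<close>
lemma no_double_point:
  assumes ab: "a \<in> V" "b \<in> V" "g a = g b" "g a \<notin> L"
    and conn: "\<And>k. k \<in> g ` V - L \<Longrightarrow> connected_component (- L) (g a) k"
  shows "a = b"
proof (rule ccontr)
  assume "a \<noteq> b"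
  define w where "w = g a"
  have w: "w \<notin> L" "g a = w" "g b = w" using ab(3,4) by (auto simp: w_def)
  obtain N where N: "winds V a (\<lambda>z. g z - w) (int N)" "card {a, b} \<le> N"
    using index_ge_zeros[OF ab(1) w(1) ab(1,2) w(2,3)] by blast
  have "N \<ge> 2" using N(2) \<open>a \<noteq> b\<close> by simp
  obtain \<psi> where \<psi>: "continuous_on L \<psi>" "\<And>z. z \<in> frontier V \<Longrightarrow> \<psi> (g z) = z"
    "\<And>u. u \<in> L \<Longrightarrow> \<psi> u \<in> frontier V \<and> g (\<psi> u) = u" by (rule continuous_inverse) blast
  have "continuous_on L (\<lambda>u. \<psi> u - a)" by (intro continuous_intros \<psi>)
  moreover have "\<psi> u - a \<noteq> 0" if "u \<in> L" for u using \<psi>(3)[OF that] frontier_disj ab by auto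
  ultimately obtain K and r :: "complex \<Rightarrow> int" and h where "finite K \<and> L \<inter> K = {} \<and>
    continuous_on L h \<and> (\<forall>u\<in>L. \<psi> u - a = exp (h u) * (\<Prod>k\<in>K. (u - k) powi r k))"
    using compact_plane_factorization[OF compact_L, of "\<lambda>u. \<psi> u - a"] by metis
  then have K: "finite K" "L \<inter> K = {}" "continuous_on L h"
    "\<And>u. u \<in> L \<Longrightarrow> \<psi> u - a = exp (h u) * (\<Prod>k\<in>K. (u - k) powi r k)" by blast+
  have hg: "continuous_on (frontier V) (\<lambda>z. h (g z))" if "continuous_on L h" for h :: "complex \<Rightarrow> complex"
    by (rule continuous_on_compose2[OF that cont_frontier]) auto
  \<comment> \<open>A value of \<open>g\<close> on \<open>V\<close> lies in the component of
    \<open>w\<close>, which gives index \<open>N\<close>; otherwise \<open>g - k\<close> is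
    zero-free on \<open>closure V\<close> and has index \<open>0\<close>.\<close>
  have "\<exists>m. winds V a (\<lambda>z. g z - k) (int N * m)" if k: "k \<in> K" for k
  proof (cases "k \<in> g ` V")
    case True
    then have "connected_component (- L) k w"
      using conn K(2) k by (auto simp: w_def connected_component_sym_eq)
    then obtain l where l: "continuous_on L l" "\<And>u. u \<in> L \<Longrightarrow> u - k = (u - w) * exp (l u)"
      using log_ratio[OF compact_imp_closed[OF compact_L]] by blast
    have "winds V a (\<lambda>z. g z - k) (int N + 0)"
      by (rule winds_cong[OF winds_mult[OF V(1) ab(1) N(1) winds_exp[OF hg[OF l(1)]]]])
        (use l in auto)
    then show ?thesis by (intro exI[of _ 1]) simp
  next
    case False
    have "winds V a (\<lambda>z. g z - k) 0"
    proof (rule winds_nonvanishing)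
      show "g z - k \<noteq> 0" if "z \<in> closure V" for z
        using closure_cases[OF that] False K(2) k by auto
    qed (intro continuous_intros cont)
    then show ?thesis by (intro exI[of _ 0]) simp
  qed
  then obtain m where m: "\<And>k. k \<in> K \<Longrightarrow> winds V a (\<lambda>z. g z - k) (int N * m k)" by metis
  have "winds V a (\<lambda>z. \<Prod>k\<in>K. (g z - k) powi r k) (\<Sum>k\<in>K. int N * m k * r k)"
    by (intro winds_prod V ab K winds_power_int m)
  \<comment> \<open>Since \<open>\<psi> (g z) = z\<close> on the frontier, substituting
    \<open>u = g z\<close> yields a factorization of \<open>z - a\<close>.\<close>
  then have "winds V a (\<lambda>z. z - a) (0 + (\<Sum>k\<in>K. int N * m k * r k))"
    by (rule winds_cong[OF winds_mult[OF V(1) ab(1) winds_exp[OF hg[OF K(3)]]]])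
      (use K(4) \<psi>(2) in force)
  moreover have "winds V a (\<lambda>z. z - a) 1" by (rule winds_linear[OF V(1,2) ab(1) ab(1)])
  ultimately have "1 = 0 + (\<Sum>k\<in>K. int N * m k * r k)"
    by (rule winds_unique[OF V(1,3) ab(1), rotated])
  then have "1 = int N * (\<Sum>k\<in>K. m k * r k)" by (simp add: sum_distrib_left mult.assoc)
  then have "int N dvd 1" by (rule dvdI)
  then show False using \<open>N \<ge> 2\<close> by simp
qed

text \<open>The plane without \<open>x\<close> is connected, and \<open>V\<close> neither misses nor
  covers it, so the frontier has a point there.\<close>

lemma frontier_not_singleton:
  assumes "V \<noteq> {}" shows "\<not> frontier V \<subseteq> {x}"
proof
  assume x: "frontier V \<subseteq> {x}"
  have "connected (- {x})" by (rule connected_punctured_universe) simp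
  moreover have "- {x} \<inter> V \<noteq> {}"
  proof
    assume "- {x} \<inter> V = {}"
    then have "V \<subseteq> {x}" by auto
    then have "V = {x}" using assms by (simp add: subset_singleton_iff)
    then show False using V(1) not_open_singleton[of x] by simp
  qed
  moreover have "- {x} - V \<noteq> {}"
  proof
    assume "- {x} - V = {}"
    then have "UNIV \<subseteq> insert x V" by auto
    then have "UNIV = insert x V" by (rule UNIV_eq_I[OF subsetD]) simp
    moreover have "bounded (insert x V)" using V(3) by simp
    ultimately show False using not_bounded_UNIV[where 'a = complex] by metis
  qed
  ultimately have "- {x} \<inter> frontier V \<noteq> {}" by (rule connected_Int_frontier)
  then show False using x by auto
qed

text \<open>A constant \<open>g\<close> would by continuity be constant on the frontier, where it is
  injective and which has at least two points.\<close>

lemma open_image: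
  assumes "open U" "U \<subseteq> V" "V \<noteq> {}"
  shows "open (g ` U)"
proof (rule open_mapping_thm[OF hol V(1,2) assms(1,2)])
  show "\<not> g constant_on V"
  proof
    assume "g constant_on V"
    then obtain c where "\<And>z. z \<in> V \<Longrightarrow> g z = c" unfolding constant_on_def by blast
    then have c: "g z = c" if "z \<in> closure V" for z
      using continuous_constant_on_closure[OF cont _ that] by blast
    obtain x where x: "x \<in> frontier V" using frontier_not_singleton[OF assms(3)] by blast
    have "frontier V \<subseteq> {x}"
    proof
      fix y assume y: "y \<in> frontier V"
      then have "g y = g x" using x c frontier_subset_closure by auto
      then show "y \<in> {x}" using inj_onD[OF inj _ y x] by simp
    qed
    then show False using frontier_not_singleton[OF assms(3)] by blast
  qed
qed

text \<open>By invariance of domain the inverse would map the interior onto an open subset of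
  \<open>frontier V\<close>, but the frontier of an open set has no interior. This allows double
  values to be moved off \<open>L\<close>.\<close>

lemma interior_L: "interior L = {}"
proof -
  obtain \<psi> where \<psi>: "continuous_on L \<psi>" "\<And>z. z \<in> frontier V \<Longrightarrow> \<psi> (g z) = z"
    "\<And>u. u \<in> L \<Longrightarrow> \<psi> u \<in> frontier V \<and> g (\<psi> u) = u" by (rule continuous_inverse) blast
  have "open (\<psi> ` interior L)"
  proof (rule invariance_of_domain)
    show "continuous_on (interior L) \<psi>" using \<psi>(1) interior_subset continuous_on_subset by blast
    show "inj_on \<psi> (interior L)" using \<psi>(3) interior_subset by (metis inj_on_inverseI subsetD)
  qed simp
  moreover have "\<psi> ` interior L \<subseteq> frontier V" using \<psi>(3) interior_subset by blast
  moreover have "interior (frontier V) = {}"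
  proof -
    have "interior (frontier V) \<inter> V = {}" using interior_subset frontier_disj by blast
    then have "interior (frontier V) \<inter> closure V = {}"
      using open_Int_closure_eq_empty[OF open_interior] by blast
    then show ?thesis using interior_subset frontier_subset_closure by blast
  qed
  ultimately have "\<psi> ` interior L = {}" using interior_maximal by blast
  then show ?thesis by simp
qed

lemma inj_on_closure:
  assumes *: "\<And>a b. a \<in> V \<Longrightarrow> b \<in> V \<Longrightarrow> g a = g b \<Longrightarrow> g a \<notin> L \<Longrightarrow> a = b"
  shows "inj_on g (closure V)"
proof -
  \<comment> \<open>The images of disjoint neighbourhoods of \<open>a\<close> and \<open>b\<close>
    overlap in a nonempty open set, which \<open>L\<close> cannot contain; so a double value off
    \<open>L\<close> arises.\<close>
  have VV: "a = b" if ab: "a \<in> V" "b \<in> V" "g a = g b" for a b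
  proof (rule ccontr)
    assume "a \<noteq> b"
    then obtain U W where UW: "open U" "open W" "a \<in> U" "b \<in> W" "U \<inter> W = {}"
      using hausdorff by metis
    have "open (g ` (U \<inter> V) \<inter> g ` (W \<inter> V))"
      using UW V ab by (intro open_Int open_image) auto
    moreover have "g a \<in> g ` (U \<inter> V) \<inter> g ` (W \<inter> V)"
      using UW(3,4) ab by (metis IntI imageI)
    ultimately have "\<not> g ` (U \<inter> V) \<inter> g ` (W \<inter> V) \<subseteq> L"
      using interior_L interior_maximal by blast
    then obtain x where x: "x \<in> g ` (U \<inter> V)" "x \<in> g ` (W \<inter> V)" "x \<notin> L" by blast
    then obtain u v where "u \<in> U \<inter> V" "v \<in> W \<inter> V" "x = g u" "x = g v" by blast
    then show False using *[of u v] UW(5) x(3) by auto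
  qed
  \<comment> \<open>By continuity, points of \<open>V\<close> near \<open>b\<close> have values in
    the image of a neighbourhood of \<open>a\<close>, against \<open>VV\<close>.\<close>
  have VF: False if ab: "a \<in> V" "b \<in> frontier V" "g a = g b" for a b
  proof -
    have "a \<noteq> b" using ab frontier_disj by auto
    then obtain U W where UW: "open U" "open W" "a \<in> U" "b \<in> W" "U \<inter> W = {}"
      using hausdorff by metis
    have bc: "b \<in> closure V" using ab frontier_subset_closure by auto
    have "open (g ` (U \<inter> V))" using UW V ab by (intro open_image) auto
    moreover have "g b \<in> g ` (U \<inter> V)" by (rule image_eqI[of _ _ a]) (use UW ab in auto)
    ultimately obtain T where T: "open T" "b \<in> T" "\<And>z. z \<in> closure V \<Longrightarrow> z \<in> T \<Longrightarrow> g z \<in> g ` (U \<inter> V)"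
      using cont bc unfolding continuous_on_topological by meson
    have "b \<in> T \<inter> W" "open (T \<inter> W)" using T UW by auto
    then have "T \<inter> W \<inter> V \<noteq> {}" using bc open_Int_closure_eq_empty by blast
    then obtain v where v: "v \<in> T" "v \<in> W" "v \<in> V" by blast
    then obtain u where "u \<in> U \<inter> V" "g u = g v" using T(3)[of v] closure_subset by force
    then show False using VV[of u v] v UW by auto
  qed
  show ?thesis
  proof (rule inj_onI)
    fix x y assume "x \<in> closure V" "y \<in> closure V" and e: "g x = g y"
    then show "x = y"
      using closure_cases[of x] closure_cases[of y] VV[of x y] VF[of x y] VF[of y x] inj_onD[OF inj e]
      by metis
  qed
qed

end

section \<open>Domains that are the only hole of their frontier\<close>

text \<open>A root off \<open>V\<close> lies outside the frontier, \<open>V\<close> being its only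
  hole, so its factor is an exponential. Unlike in \<open>winds_poly\<close>, the remaining factor
  has a logarithm on the frontier, which can be transported to \<open>L\<close>.\<close>

lemma poly_on_regular_frontier:
  assumes V: "open V" "connected V" "holes (frontier V) = {V}" "bounded V" "a \<in> V"
    and "q \<noteq> 0" "\<And>z. z \<in> frontier V \<Longrightarrow> poly q z \<noteq> 0"
  shows "\<exists>(n::nat) h. continuous_on (frontier V) h \<and>
     (\<forall>z\<in>frontier V. poly q z = (z - a) ^ n * exp (h z))"
  using assms(6,7)
proof (induction q rule: complex_poly_induct)
  case (const c)
  then show ?case by (intro exI[of _ 0] exI[of _ "\<lambda>_. Ln c"]) auto
next
  case (linear c q)
  have "poly q z \<noteq> 0" if "z \<in> frontier V" for z using linear(3)[OF that] by auto
  then obtain n h where h: "continuous_on (frontier V) h"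
    "\<And>z. z \<in> frontier V \<Longrightarrow> poly q z = (z - a) ^ n * exp (h z)"
    using linear.IH by blast
  have c: "c \<notin> frontier V" using linear(3)[of c] by auto
  have eq: "poly ([:-c, 1:] * q) z = (z - c) * poly q z" for z
    by (simp add: algebra_simps del: mult_pCons_left)
  show ?case
  proof (cases "c \<in> V")
    case True
    have "V \<subseteq> - frontier V" using V(1) by (auto simp: frontier_def interior_open)
    then have "connected_component (- frontier V) c a"
      using V(2,5) True unfolding connected_component_def by (intro exI[of _ V]) auto
    then obtain l where l: "continuous_on (frontier V) l"
      "\<And>z. z \<in> frontier V \<Longrightarrow> z - c = (z - a) * exp (l z)"
      using log_ratio[OF frontier_closed] by blast
    have "poly ([:-c, 1:] * q) z = (z - a) ^ Suc n * exp (l z + h z)" if "z \<in> frontier V" for z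
      unfolding eq using l(2)[OF that] h(2)[OF that] by (simp add: exp_add)
    moreover have "continuous_on (frontier V) (\<lambda>z. l z + h z)" by (intro continuous_intros l h)
    ultimately show ?thesis by (intro exI[of _ "Suc n"] exI[of _ "\<lambda>z. l z + h z"]) blast
  next
    case False
    then have "c \<notin> poly_hull (frontier V)" using V(3) c by (simp add: poly_hull_def)
    then have "c \<in> outside (frontier V)" by (simp add: poly_hull_eq_inside union_with_inside)
    moreover have "compact (frontier V)" using V(4) by (simp add: compact_frontier_bounded)
    ultimately obtain l where l: "continuous_on (frontier V) l"
      "\<And>z. z \<in> frontier V \<Longrightarrow> z - c = exp (l z)"
      using log_outside[of "frontier V" c] by blast
    have "poly ([:-c, 1:] * q) z = (z - a) ^ n * exp (l z + h z)" if "z \<in> frontier V" for z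
      unfolding eq using l(2)[OF that] h(2)[OF that] by (simp add: exp_add)
    moreover have "continuous_on (frontier V) (\<lambda>z. l z + h z)" by (intro continuous_intros l h)
    ultimately show ?thesis by (intro exI[of _ n] exI[of _ "\<lambda>z. l z + h z"]) blast
  qed
qed

context frontier_injective
begin

text \<open>The exponent is the index of \<open>g - g c\<close>, which is positive because of the
  zero at \<open>c\<close>.\<close>

lemma regular_factorization:
  assumes "holes (frontier V) = {V}" "a \<in> V" "c \<in> V" "g c \<notin> L"
  shows "\<exists>(n::nat) h. n > 0 \<and> continuous_on (frontier V) h \<and>
     (\<forall>z\<in>frontier V. g z - g c = (z - a) ^ n * exp (h z))"
proof -
  have cc: "c \<in> closure V" using assms(3) closure_subset by auto
  obtain q h where q: "continuous_on (frontier V) h"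
     "\<And>z. z \<in> frontier V \<Longrightarrow> poly q z \<noteq> 0"
     "\<And>z. z \<in> frontier V \<Longrightarrow> g z - g c = poly q z * exp (h z)"
    using poly_factor[OF assms(4) cc cc refl refl] by blast
  have "frontier V \<noteq> {}" using assms(3) V(3) by (auto simp: frontier_eq_empty)
  then have "q \<noteq> 0" using q(2) by fastforce
  then obtain n::nat and l where l: "continuous_on (frontier V) l"
     "\<And>z. z \<in> frontier V \<Longrightarrow> poly q z = (z - a) ^ n * exp (l z)"
    using poly_on_regular_frontier[OF V(1,2) assms(1) V(3) assms(2) _ q(2)] by blast
  have c: "continuous_on (frontier V) (\<lambda>z. l z + h z)" by (intro continuous_intros l q)
  have e: "g z - g c = (z - a) ^ n * exp (l z + h z)" if "z \<in> frontier V" for z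
    using q(3)[OF that] l(2)[OF that] by (simp add: exp_add)
  have "winds V a (\<lambda>z. (z - a) powi int n) (1 * int n)"
    by (rule winds_power_int[OF winds_linear[OF V(1,2) assms(2,2)]])
  then have "winds V a (\<lambda>z. g z - g c) (1 * int n + 0)"
    by (rule winds_cong[OF winds_mult[OF V(1) assms(2) _ winds_exp[OF c]]]) (use e in auto)
  moreover obtain m where m: "winds V a (\<lambda>z. g z - g c) (int m)" "card {c, c} \<le> m"
    using index_ge_zeros[OF assms(2,4,3,3) refl refl] by blast
  ultimately have "1 * int n + 0 = int m" using winds_unique[OF V(1,3) assms(2)] by blast
  then have "n > 0" using m(2) by simp
  then show ?thesis using c e by (intro exI[of _ n] exI[of _ "\<lambda>z. l z + h z"]) auto
qed

text \<open>On \<open>frontier V\<close> all functions \<open>g - k\<close> are powers of \<open>z - a\<close> up to exponentials. Two values \<open>w, k\<close> in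
  different components of \<open>- L\<close> would thus give a relation between powers of \<open>u - w\<close> and
  \<open>u - k\<close> on \<open>L\<close>, which the index with respect to the component of \<open>k\<close> forbids.\<close>
lemma inj_on_closure_regular:
  assumes reg: "holes (frontier V) = {V}"
  shows "inj_on g (closure V)"
proof (rule inj_on_closure, rule no_double_point)
  fix a b k assume ab: "a \<in> V" "g a \<notin> L" and "k \<in> g ` V - L"
  then obtain c where c: "c \<in> V" "k = g c" "g c \<notin> L" by auto
  define w where "w = g a"
  show "connected_component (- L) (g a) k"
  proof (rule ccontr)
    assume no: "\<not> connected_component (- L) (g a) k"
    define W where "W = connected_component_set (- L) k"
    have clL: "closed L" by (rule compact_imp_closed[OF compact_L])
    \<comment> \<open>Boundedness holds because \<open>image_inside\<close> places \<open>k\<close>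
      inside \<open>L\<close>.\<close>
    have W: "open W" "connected W" "bounded W" "k \<in> W"
      using image_inside[OF c(1,3)] c clL
      by (auto simp: W_def inside_def closed_def intro!: open_connected_component)
    have fW: "frontier W \<subseteq> L"
      using frontier_of_connected_component_subset[of "- L" k] frontier_subset_closed[OF clL]
      unfolding W_def frontier_complement by (rule order_trans)
    have "w \<notin> W" using no by (auto simp: W_def w_def connected_component_sym_eq)
    then have w: "w \<notin> closure W"
      using fW ab(2) W(1) by (auto simp: frontier_def interior_open w_def)
    obtain n::nat and h where n: "n > 0" "continuous_on (frontier V) h"
        "\<And>z. z \<in> frontier V \<Longrightarrow> g z - w = (z - a) ^ n * exp (h z)"
      using regular_factorization[OF reg ab(1,1,2)] unfolding w_def by blast
    obtain m::nat and l where m: "m > 0" "continuous_on (frontier V) l"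
        "\<And>z. z \<in> frontier V \<Longrightarrow> g z - k = (z - a) ^ m * exp (l z)"
      using regular_factorization[OF reg ab(1) c(1,3)] unfolding c(2) by blast
    obtain \<psi> where \<psi>: "continuous_on L \<psi>" "\<And>z. z \<in> frontier V \<Longrightarrow> \<psi> (g z) = z"
      "\<And>u. u \<in> L \<Longrightarrow> \<psi> u \<in> frontier V \<and> g (\<psi> u) = u" by (rule continuous_inverse) blast
    \<comment> \<open>The powers \<open>m\<close> of \<open>g - w\<close> and \<open>n\<close> of
      \<open>g - k\<close> contain the same power of \<open>z - a\<close>; \<open>e\<close> collects
      the remaining exponents.\<close>
    define e where "e = (\<lambda>u. of_nat m * h (\<psi> u) - of_nat n * l (\<psi> u))"
    have "continuous_on L (\<lambda>u. h (\<psi> u))" "continuous_on L (\<lambda>u. l (\<psi> u))"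
      by (rule continuous_on_compose2[OF n(2) \<psi>(1)], use \<psi>(3) in blast)
        (rule continuous_on_compose2[OF m(2) \<psi>(1)], use \<psi>(3) in blast)
    then have "continuous_on L e" unfolding e_def by (intro continuous_intros)
    then have ce: "continuous_on (frontier W) e" using fW continuous_on_subset by blast
    have rel: "(u - w) powi int m = (u - k) powi int n * exp (e u)" if "u \<in> frontier W" for u
    proof -
      have u: "\<psi> u \<in> frontier V" "g (\<psi> u) = u" using \<psi>(3) fW that by auto
      have "(u - w) ^ m = ((\<psi> u - a) ^ n * exp (h (\<psi> u))) ^ m" using n(3)[OF u(1)] u(2) by simp
      also have "\<dots> = ((\<psi> u - a) ^ m) ^ n * exp (of_nat m * h (\<psi> u))"
        by (simp add: power_mult_distrib exp_of_nat_mult power_mult[symmetric] mult.commute)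
      also have "\<dots> = ((\<psi> u - a) ^ m * exp (l (\<psi> u))) ^ n * exp (e u)"
        by (simp add: power_mult_distrib e_def exp_diff exp_of_nat_mult)
      also have "(\<psi> u - a) ^ m * exp (l (\<psi> u)) = u - k" using m(3)[OF u(1)] u(2) by simp
      finally show ?thesis by simp
    qed
    \<comment> \<open>As \<open>w\<close> is off \<open>closure W\<close>, the left side of
      \<open>rel\<close> has index \<open>0\<close>, while the right side has index
      \<open>n\<close>.\<close>
    have "winds W k (\<lambda>u. u - w) 0"
      by (rule winds_nonvanishing) (use w in \<open>auto intro!: continuous_intros\<close>)
    then have "winds W k (\<lambda>u. (u - w) powi int m) (0 * int m)"
      by (rule winds_power_int)
    moreover have "winds W k (\<lambda>u. (u - w) powi int m) (1 * int n + 0)"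
      by (rule winds_cong[OF winds_mult[OF W(1,4)
            winds_power_int[OF winds_linear[OF W(1,2,4,4)]] winds_exp[OF ce]] rel])
    ultimately have "0 * int m = 1 * int n + 0" using winds_unique[OF W(1,3,4)] by blast
    then show False using n(1) by simp
  qed
qed

text \<open>The image of \<open>V\<close> is open and lies in the hull of \<open>T\<close>, hence in
  its interior, which misses the frontier \<open>L\<close>. Being connected, it stays in one
  component of \<open>- L\<close>.\<close>

lemma inj_on_closure_outer:
  assumes "compact T" "L = outer_boundary T"
  shows "inj_on g (closure V)"
proof (cases "V = {}")
  case False
  have "L \<union> inside L \<subseteq> poly_hull T"
    using outer_boundary_subset[OF assms(1)] inside_mono[of L T] assms(2)
    by (auto simp: poly_hull_eq_inside)
  then have "g ` V \<subseteq> poly_hull T" using image_inside by blast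
  then have "g ` V \<subseteq> interior (poly_hull T)"
    using open_image[OF V(1) order_refl False] by (rule interior_maximal)
  then have disj: "g ` V \<subseteq> - L" using assms(2) by (auto simp: outer_boundary_def frontier_def)
  have "connected (g ` V)"
    using hol V(2) by (intro connected_continuous_image holomorphic_on_imp_continuous_on)
  then have conn: "connected_component (- L) (g a) k" if "a \<in> V" "k \<in> g ` V - L" for a k
    using disj that unfolding connected_component_def by blast
  show ?thesis
    by (rule inj_on_closure, rule no_double_point) (assumption | rule conn)+
qed simp

end

section \<open>Holes and the Gelfand transform\<close>

lemma poly_hull_superset_bounded:
  assumes "open V" "bounded V" "frontier V \<subseteq> X"
  shows "V \<subseteq> poly_hull X"
  using interior_inside_frontier[OF assms(2)] inside_mono[OF assms(3)] assms(1)
  by (auto simp: poly_hull_eq_inside interior_open)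

text \<open>By the maximum modulus principle, polynomials that approximate \<open>f\<close> on
  \<open>X\<close> approximate the transform on the hull, which contains
  \<open>closure V\<close>.\<close>

lemma gelfand_frontier_injective:
  assumes X: "compact X" "f \<in> P_alg X" "inj_on f X"
    and V: "open V" "connected V" "bounded V" "frontier V \<subseteq> X"
  shows "frontier_injective V (gelfand X f)"
    and "\<And>z. z \<in> X \<Longrightarrow> gelfand X f z = f z"
proof -
  let ?K = "poly_hull X" and ?g = "gelfand X f"
  have "continuous_on ?K ?g \<and> ?g holomorphic_on interior ?K \<and> (\<forall>z\<in>X. ?g z = f z) \<and>
      (\<forall>z. z \<notin> ?K \<longrightarrow> ?g z = 0)"
    unfolding gelfand_def by (rule theI'[OF gelfand_ex1[OF X(1,2)]])
  then have g: "continuous_on ?K ?g" "?g holomorphic_on interior ?K"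
    and gf: "\<And>z. z \<in> X \<Longrightarrow> ?g z = f z" by auto
  show "\<And>z. z \<in> X \<Longrightarrow> gelfand X f z = f z" by (rule gf)
  have VK: "V \<subseteq> ?K" by (rule poly_hull_superset_bounded[OF V(1,3,4)])
  then have cVK: "closure V \<subseteq> ?K"
    using compact_imp_closed[OF compact_poly_hull[OF X(1)]] closure_minimal by blast
  show "frontier_injective V ?g"
  proof
    show "continuous_on (closure V) ?g" using g(1) cVK by (rule continuous_on_subset)
    show "?g holomorphic_on V" using g(2) interior_maximal[OF VK V(1)] by (rule holomorphic_on_subset)
    show "inj_on ?g (frontier V)"
      using inj_on_subset[OF X(3) V(4)] gf V(4) by (subst inj_on_cong[of _ _ f]) auto
    fix e :: real assume e: "e > 0"
    then obtain p where p: "\<And>z. z \<in> X \<Longrightarrow> cmod (f z - poly p z) < e / 2"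
      using X(2) half_gt_zero[OF e] unfolding P_alg_def by blast
    \<comment> \<open>Maximum modulus yields a non-strict bound, hence the margin
      \<open>e / 2\<close>.\<close>
    have "cmod (?g z - poly p z) \<le> e / 2" if "z \<in> ?K" for z
      by (rule max_modulus_poly_hull[OF X(1) _ _ _ that])
        (use g gf p in \<open>auto intro!: continuous_intros holomorphic_intros less_imp_le\<close>)
    then have "\<forall>z\<in>closure V. cmod (?g z - poly p z) < e" using e cVK by fastforce
    then show "\<exists>p. \<forall>z\<in>closure V. cmod (?g z - poly p z) < e" by blast
  qed (use V in auto)
qed

lemma hole_properties:
  assumes "compact X" "H \<in> holes X"
  shows "open H" "connected H" "bounded H" "frontier H \<subseteq> X" "H \<noteq> {}"
proof -
  have H: "H \<in> components (- X)" "bounded H" using assms(2) by (auto simp: holes_def)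
  have "closed X" by (rule compact_imp_closed[OF assms(1)])
  then show "open H" "frontier H \<subseteq> X"
    using H frontier_of_components_closed_complement open_components[of "- X"] by (auto simp: open_Compl)
  show "connected H" "bounded H" "H \<noteq> {}"
    using H in_components_connected in_components_nonempty by auto
qed

text \<open>\<open>Y\<close> is \<open>outer_boundary X\<close> under condition (2) and
  \<open>X\<close> under condition (3).\<close>

lemma gelfand_inj_on_regular:
  assumes X: "compact X" "f \<in> P_alg X" "inj_on f X"
    and Y: "compact Y" "Y \<subseteq> X" "G \<in> holes Y" "holes (frontier G) = {G}"
  shows "inj_on (gelfand X f) (closure G)"
proof -
  note G = hole_properties[OF Y(1,3)]
  have "frontier_injective G (gelfand X f)"
    using gelfand_frontier_injective[OF X G(1,2,3)] G(4) Y(2) by blast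
  then show ?thesis by (rule frontier_injective.inj_on_closure_regular) (rule Y(4))
qed

text \<open>\<open>V\<close> is the component of the interior of the hull that contains
  \<open>H\<close>. Its closure contains \<open>closure H\<close> and hence \<open>D\<close>, so it
  reaches every point of the outer boundary.\<close>

lemma frontier_component_interior_hull:
  assumes H: "open H" "connected H" "bounded H" "H \<noteq> {}"
  defines "D \<equiv> frontier (closure H)"
  shows "\<exists>V. open V \<and> connected V \<and> bounded V \<and> H \<subseteq> V \<and> frontier V = outer_boundary D"
proof -
  let ?I = "interior (poly_hull D)"
  have cD: "compact D" unfolding D_def by (rule compact_frontier_bounded[OF bounded_closure[OF H(3)]])
  have "closure H = interior (closure H) \<union> D"
    unfolding D_def frontier_def using interior_subset[of "closure H"] by auto
  moreover have "interior (closure H) \<subseteq> inside D"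
    unfolding D_def by (intro interior_inside_frontier bounded_closure H(3))
  ultimately have "closure H \<subseteq> poly_hull D" by (auto simp: poly_hull_eq_inside)
  then have HI: "H \<subseteq> ?I" using H(1) closure_subset by (intro interior_maximal) blast+
  obtain x where x: "x \<in> H" using H(4) by blast
  define V where "V = connected_component_set ?I x"
  have HV: "H \<subseteq> V" unfolding V_def by (rule connected_component_maximal[OF x H(2) HI])
  have VI: "V \<subseteq> ?I" unfolding V_def by (rule connected_component_subset)
  have oV: "open V" "connected V" unfolding V_def by (auto intro: open_connected_component)
  have "bounded V"
    using VI interior_subset compact_imp_bounded[OF compact_poly_hull[OF cD]] bounded_subset by blast
  moreover have "frontier V = outer_boundary D"
  proof
    have "frontier V \<subseteq> frontier ?I" unfolding V_def by (rule frontier_of_connected_component_subset)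
    also have "\<dots> \<subseteq> outer_boundary D" unfolding outer_boundary_def by (rule frontier_interior_subset)
    finally show "frontier V \<subseteq> outer_boundary D" .
    have "D \<subseteq> closure V"
      using closure_mono[OF HV] by (auto simp: D_def frontier_def)
    then have "outer_boundary D \<subseteq> closure V" using outer_boundary_subset[OF cD] by blast
    moreover have "outer_boundary D \<inter> V = {}" using VI by (auto simp: outer_boundary_def frontier_def)
    ultimately show "outer_boundary D \<subseteq> frontier V" using oV by (auto simp: frontier_def interior_open)
  qed
  ultimately show ?thesis using oV HV by blast
qed

theorem corollary2p13:
  fixes X H :: "complex set" and f :: "complex \<Rightarrow> complex"
  assumes "compact X"
    and "H \<in> holes X"
    and "f \<in> P_alg X"
    and "inj_on f X"
  shows "(f ` outer_boundary (frontier (closure H)) = outer_boundary (f ` frontier (closure H))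
            \<longrightarrow> inj_on (gelfand X f) (closure H))
       \<and> ((\<exists>G \<in> holes (outer_boundary X). H \<subseteq> G \<and> holes (frontier G) = {G})
            \<longrightarrow> inj_on (gelfand X f) (closure H))
       \<and> (regular_hole X H \<longrightarrow> inj_on (gelfand X f) (closure H))"
proof (intro conjI impI)
  note H = hole_properties[OF assms(1,2)]
  let ?D = "frontier (closure H)"
  have D: "compact ?D" by (rule compact_frontier_bounded[OF bounded_closure[OF H(3)]])
  have "?D \<subseteq> frontier H"
    using interior_mono[OF closure_subset[of H]] by (auto simp: frontier_def)
  then have DX: "?D \<subseteq> X" using H(4) by blast
  obtain V where V: "open V" "connected V" "bounded V" "H \<subseteq> V" "frontier V = outer_boundary ?D"
    using frontier_component_interior_hull[OF H(1,2,3,5)] by blast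
  have fV: "frontier V \<subseteq> X" using V(5) outer_boundary_subset[OF D] DX by blast
  note gel = gelfand_frontier_injective[OF assms(1,3,4) V(1-3) fV]
  assume "f ` outer_boundary ?D = outer_boundary (f ` ?D)"
  moreover have "gelfand X f ` frontier V = f ` frontier V"
    using gel(2) fV by (intro image_cong) auto
  \<comment> \<open>Condition (1) makes the image of \<open>frontier V\<close> the outer boundary of
    a compact set, as \<open>inj_on_closure_outer\<close> requires.\<close>
  ultimately have "gelfand X f ` frontier V = outer_boundary (f ` ?D)" using V(5) by simp
  moreover have "compact (f ` ?D)"
    using assms(3) D DX continuous_on_subset by (intro compact_continuous_image) (auto simp: P_alg_def)
  ultimately have "inj_on (gelfand X f) (closure V)"
    using frontier_injective.inj_on_closure_outer[OF gel(1)] by blast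
  then show "inj_on (gelfand X f) (closure H)"
    using closure_mono[OF V(4)] by (rule inj_on_subset)
next
  assume "\<exists>G \<in> holes (outer_boundary X). H \<subseteq> G \<and> holes (frontier G) = {G}"
  then obtain G where G: "G \<in> holes (outer_boundary X)" "H \<subseteq> G" "holes (frontier G) = {G}" by blast
  have "compact (outer_boundary X)"
    unfolding outer_boundary_def
    by (rule compact_frontier_bounded[OF compact_imp_bounded[OF compact_poly_hull[OF assms(1)]]])
  then have "inj_on (gelfand X f) (closure G)"
    using gelfand_inj_on_regular[OF assms(1,3,4) _ outer_boundary_subset[OF assms(1)] G(1,3)] by blast
  then show "inj_on (gelfand X f) (closure H)"
    using closure_mono[OF G(2)] by (rule inj_on_subset)
next
  assume "regular_hole X H"
  then show "inj_on (gelfand X f) (closure H)"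
    unfolding regular_hole_def
    using gelfand_inj_on_regular[OF assms(1,3,4,1) order_refl] by blast
qed

end
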